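(* Let $G$ be a graph, $S_0\subsetneq E(G)$, and let $\gamma:G\to H=G/S_0$ be the contraction of $S_0$. Let $b\in\{0,1\}$. Then the map $\overline\gamma_*:\overline{\mathcal{OP}}^b_G\to\overline{\mathcal{OP}}^b_H$ is a quotient of posets, and it maps $\overline{\mathcal O}^b(G-\gamma^*T)$ onto $\overline{\mathcal O}^b(H-T)$ for every $T\in\mathcal A^b_H$.
   Context: **Graphs.** A graph $G$ is finite, with vertex set $V$, edge set $E$, weight function $w:V\to\mathbb N$; loops and multiple edges are allowed; each edge consists of two half-edges, each having an end in $V$. The genus is $g(G)=\sum_{v}w(v)-|V|+|E|+c(G)$, with $c(G)$ the number of connected components. $G-S$ is $G$ with the edges of $S$ deleted. For $\emptyset\neq Z\subsetneq V$, the cut $E(Z,Z^c)$ is the set of edges joining $Z$ to $Z^c=V\setminus Z$; a bridge is an edge $e$ such that $\{e\}$ is a cut; $G_{br}$ is the set of bridges. $G[Z]$ is the induced subgraph. **Contraction.** $G/S_0$ is obtained by contracting every edge of $S_0$; $E(G/S_0)=E(G)\setminus S_0$; the weight of a vertex $v$ of $G/S_0$ is the genus of the connected subgraph of $G$ contracted to $v$. **Orientations.** A generalized orientation assigns to each edge one direction or both (bioriented: both ends are sources and targets); a $b$-orientation has exactly $b$ bioriented edges. A $0$-orientation is totally cyclic if every nonempty cut $E(Z,Z^c)$ has an edge with target in $Z$ and one with target in $Z^c$. A $1$-orientation with bioriented edge $e$ is rooted if for every $Z\subsetneq V$ with $e\in G[Z]$ the cut $E(Z,Z^c)$ has an edge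 with target in $Z^c$. $\mathcal O^0(G)$, $\mathcal O^1(G)$: sets of totally cyclic $0$-orientations, resp. rooted $1$-orientations. If $G$ has no edges, $\mathcal O^0(G)$ consists of the empty orientation; if $G$ is a single vertex without edges, $\mathcal O^1(G)$ also consists of the empty orientation. For $O\in\mathcal O^b(G)$: $\underline d^O\in\mathbb Z^V$, $\underline d^O_v=w(v)-1+\underline t^O_v$ with $\underline t^O_v$ the number of half-edges with target $v$ if $E\ne\emptyset$, and $\underline d^O_v=w(v)-1+b$ if $E=\emptyset$. $O\sim O'$ iff $\underline d^O=\underline d^{O'}$; $\overline O$ denotes the class and $\overline{\mathcal O}^b(G)=\mathcal O^b(G)/\sim$. The subscript in $O_S$ means the orientation is on $G-S$. **Posets.** $\mathcal A^0_G=\{S\subset E:(G-S)_{br}=\emptyset\}$, $\mathcal A^1_G=\{S\subset E:G-S\text{ connected}\}$, ordered by $S\le T$ iff $T\subset S$. $\overline{\mathcal{OP}}^b_G=\bigsqcup_{S\in\mathcal A^b_G}\overline{\mathcal O}^b(G-S)$, with $\overline O_S\le\overline O_T$ iff $T\subset S$ and there exist $O'_S\sim O_S$, $O'_T\sim O_T$ with $(O'_T)_{|G-S}=O'_S$. A quotient of posets is an order-preserving map $\mu:\mathcal P\to\mathcal Q$ such that for all $q_1\le q_2$ in $\mathcal Q$ there are $p_i\in\mu^{-1}(q_i)$ with $p_1\le p_2$. **Push-forward, pull-back.** For $S\in\mathcal A^b_G$: $\gamma_*S=S\setminus S_0\in\mathcal A^b_H$. For $T\in\mathcal A^b_H$: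 $\gamma^*T=T\cup(G-T)_{br}$ if $b=0$, $\gamma^*T=T$ if $b=1$; it lies in $\mathcal A^b_G$. $\overline\gamma_*\overline O_S$ is the class of the restriction $(O'_S)_{|H-\gamma_*S}$ (note $E(H-\gamma_*S)\subset E(G-S)$), where $O'_S=O_S$ if $b=0$, and if $b=1$, $O'_S\sim O_S$ is any representative whose bioriented edge is not in $S_0$; if $b=1$ and all edges of $G-S$ lie in $S_0$ (so $H$ has one vertex and $H-\gamma_*S$ no edges), $\overline\gamma_*\overline O_S$ is the class of the empty orientation. *)

theory Defs
  imports "HOL-Library.FuncSet"
begin

text \<open>
  The two half-edges of an edge \<open>e\<close> are \<open>(e, False)\<close> and \<open>(e, True)\<close>; \<open>endpt G e i\<close> is the end
  of the half-edge \<open>(e, i)\<close>. The labels only serve to tell the two half-edges apart, also when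
  \<open>e\<close> is a loop.
\<close>

record ('v, 'e) wgraph =
  verts :: "'v set"
  edges :: "'e set"
  endpt :: "'e \<Rightarrow> bool \<Rightarrow> 'v"
  weight :: "'v \<Rightarrow> nat"

locale weighted_graph =
  fixes G :: "('v, 'e) wgraph"
  assumes finite_verts: "finite (verts G)"
    and finite_edges: "finite (edges G)"
    and endpt_in_verts: "e \<in> edges G \<Longrightarrow> endpt G e i \<in> verts G"

definition half_edges :: "('v, 'e) wgraph \<Rightarrow> ('e \<times> bool) set" where
  "half_edges G = edges G \<times> UNIV"

definition delete :: "('v, 'e) wgraph \<Rightarrow> 'e set \<Rightarrow> ('v, 'e) wgraph" where
  "delete G S = G\<lparr>edges := edges G - S\<rparr>"

definition induced :: "('v, 'e) wgraph \<Rightarrow> 'v set \<Rightarrow> ('v, 'e) wgraph" where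
  "induced G Z = G\<lparr>verts := Z, edges := {e \<in> edges G. \<forall>i. endpt G e i \<in> Z}\<rparr>"

definition reachable :: "('v, 'e) wgraph \<Rightarrow> ('v \<times> 'v) set" where
  "reachable G = {(endpt G e i, endpt G e (\<not> i)) | e i. e \<in> edges G}\<^sup>* \<inter> (verts G \<times> verts G)"

definition components :: "('v, 'e) wgraph \<Rightarrow> 'v set set" where
  "components G = verts G // reachable G"

definition connected_graph :: "('v, 'e) wgraph \<Rightarrow> bool" where
  "connected_graph G \<longleftrightarrow> card (components G) = 1"

definition genus :: "('v, 'e) wgraph \<Rightarrow> int" where
  "genus G = (\<Sum>v\<in>verts G. int (weight G v)) - int (card (verts G)) + int (card (edges G))
     + int (card (components G))"

definition cut :: "('v, 'e) wgraph \<Rightarrow> 'v set \<Rightarrow> 'e set" where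
  "cut G Z = {e \<in> edges G. \<exists>i. endpt G e i \<in> Z \<and> endpt G e (\<not> i) \<in> verts G - Z}"

definition bridges :: "('v, 'e) wgraph \<Rightarrow> 'e set" where
  "bridges G = {e \<in> edges G. \<exists>Z. Z \<noteq> {} \<and> Z \<subset> verts G \<and> cut G Z = {e}}"

text \<open>
  The subgraph \<open>induced K C\<close> is connected with edges in \<open>S\<close>, so its genus is nonnegative and
  \<open>nat\<close> does not truncate.
\<close>

definition contract :: "('v, 'e) wgraph \<Rightarrow> 'e set \<Rightarrow> ('v set, 'e) wgraph" where
  "contract G S = (let K = G\<lparr>edges := edges G \<inter> S\<rparr> in
     \<lparr>verts = components K,
      edges = edges G - S,
      endpt = (\<lambda>e i. reachable K `` {endpt G e i}),
      weight = (\<lambda>C. nat (genus (induced K C)))\<rparr>)"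

text \<open>
  A generalized orientation is encoded by the set \<open>X\<close> of half-edges that are targets: an edge
  \<open>e\<close> with exactly one half-edge in \<open>X\<close> is directed towards the end of that half-edge, and
  \<open>e\<close> is bioriented if both its half-edges are in \<open>X\<close>.
\<close>

definition bioriented :: "('e \<times> bool) set \<Rightarrow> 'e set" where
  "bioriented X = {e. (e, False) \<in> X \<and> (e, True) \<in> X}"

definition gen_orientation :: "('v, 'e) wgraph \<Rightarrow> ('e \<times> bool) set \<Rightarrow> bool" where
  "gen_orientation G X \<longleftrightarrow> X \<subseteq> half_edges G \<and> (\<forall>e\<in>edges G. \<exists>i. (e, i) \<in> X)"

definition b_orientation :: "nat \<Rightarrow> ('v, 'e) wgraph \<Rightarrow> ('e \<times> bool) set \<Rightarrow> bool" where
  "b_orientation b G X \<longleftrightarrow> gen_orientation G X \<and> card (bioriented X) = b"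

definition has_target_in ::
  "('v, 'e) wgraph \<Rightarrow> ('e \<times> bool) set \<Rightarrow> 'e \<Rightarrow> 'v set \<Rightarrow> bool" where
  "has_target_in G X e Z \<longleftrightarrow> (\<exists>i. (e, i) \<in> X \<and> endpt G e i \<in> Z)"

definition totally_cyclic :: "('v, 'e) wgraph \<Rightarrow> ('e \<times> bool) set \<Rightarrow> bool" where
  "totally_cyclic G X \<longleftrightarrow> b_orientation 0 G X \<and>
     (\<forall>Z. Z \<noteq> {} \<and> Z \<subset> verts G \<and> cut G Z \<noteq> {} \<longrightarrow>
        (\<exists>e\<in>cut G Z. has_target_in G X e Z) \<and>
        (\<exists>e\<in>cut G Z. has_target_in G X e (verts G - Z)))"

definition rooted :: "('v, 'e) wgraph \<Rightarrow> ('e \<times> bool) set \<Rightarrow> bool" where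
  "rooted G X \<longleftrightarrow> b_orientation 1 G X \<and>
     (\<forall>e\<in>bioriented X. \<forall>Z. Z \<subset> verts G \<and> e \<in> edges (induced G Z) \<longrightarrow>
        (\<exists>e'\<in>cut G Z. has_target_in G X e' (verts G - Z)))"

text \<open>
  The definition is only meant for \<open>b = 0\<close> and \<open>b = 1\<close>. If \<open>G\<close> has no edges, the empty set is its
  only totally cyclic orientation; for \<open>b = 1\<close> the one-vertex graph is a separate case, since
  an edgeless graph has no orientation with a bioriented edge.
\<close>

definition orientations :: "nat \<Rightarrow> ('v, 'e) wgraph \<Rightarrow> ('e \<times> bool) set set" where
  "orientations b G =
     (if b = 0 then {X. totally_cyclic G X}
      else if edges G = {} \<and> card (verts G) = 1 then {{}}
      else {X. rooted G X})"

definition target_count :: "('v, 'e) wgraph \<Rightarrow> ('e \<times> bool) set \<Rightarrow> 'v \<Rightarrow> nat" where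
  "target_count G X v = card {(e, i). (e, i) \<in> X \<and> endpt G e i = v}"

definition divisor :: "nat \<Rightarrow> ('v, 'e) wgraph \<Rightarrow> ('e \<times> bool) set \<Rightarrow> 'v \<Rightarrow> int" where
  "divisor b G X = (\<lambda>v\<in>verts G. int (weight G v) - 1 +
     (if edges G \<noteq> {} then int (target_count G X v) else int b))"

definition orient_equiv ::
  "nat \<Rightarrow> ('v, 'e) wgraph \<Rightarrow> (('e \<times> bool) set \<times> ('e \<times> bool) set) set" where
  "orient_equiv b G =
     {(X, Y). X \<in> orientations b G \<and> Y \<in> orientations b G \<and> divisor b G X = divisor b G Y}"

definition orientation_classes :: "nat \<Rightarrow> ('v, 'e) wgraph \<Rightarrow> ('e \<times> bool) set set set" where
  "orientation_classes b G = orientations b G // orient_equiv b G"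

definition restrict_orientation :: "('e \<times> bool) set \<Rightarrow> ('v, 'e) wgraph \<Rightarrow> ('e \<times> bool) set" where
  "restrict_orientation X G = X \<inter> half_edges G"

definition admissible_sets :: "nat \<Rightarrow> ('v, 'e) wgraph \<Rightarrow> 'e set set" where
  "admissible_sets b G =
     {S. S \<subseteq> edges G \<and>
        (if b = 0 then bridges (delete G S) = {} else connected_graph (delete G S))}"

text \<open>
  The disjoint union over \<open>S\<close> is the set of pairs \<open>(S, C)\<close> with \<open>C\<close> a class of orientations
  on \<open>G - S\<close>.
\<close>

definition OP :: "nat \<Rightarrow> ('v, 'e) wgraph \<Rightarrow> ('e set \<times> ('e \<times> bool) set set) set" where
  "OP b G = Sigma (admissible_sets b G) (\<lambda>S. orientation_classes b (delete G S))"

definition OP_order :: "nat \<Rightarrow> ('v, 'e) wgraph \<Rightarrow>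
    (('e set \<times> ('e \<times> bool) set set) \<times> ('e set \<times> ('e \<times> bool) set set)) set" where
  "OP_order b G =
     {((S, C), (T, D)). (S, C) \<in> OP b G \<and> (T, D) \<in> OP b G \<and> T \<subseteq> S \<and>
        (\<exists>X\<in>C. \<exists>Y\<in>D. restrict_orientation Y (delete G S) = X)}"

definition poset_quotient ::
  "'p set \<Rightarrow> ('p \<times> 'p) set \<Rightarrow> 'q set \<Rightarrow> ('q \<times> 'q) set \<Rightarrow> ('p \<Rightarrow> 'q) \<Rightarrow> bool" where
  "poset_quotient P r Q s \<mu> \<longleftrightarrow>
     partial_order_on P r \<and> partial_order_on Q s \<and>
     \<mu> \<in> P \<rightarrow> Q \<and>
     monotone_on P (\<lambda>x y. (x, y) \<in> r) (\<lambda>x y. (x, y) \<in> s) \<mu> \<and>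
     (\<forall>q1 q2. (q1, q2) \<in> s \<longrightarrow>
        (\<exists>p1\<in>P. \<exists>p2\<in>P. \<mu> p1 = q1 \<and> \<mu> p2 = q2 \<and> (p1, p2) \<in> r))"

definition push_set :: "'e set \<Rightarrow> 'e set \<Rightarrow> 'e set" where
  "push_set S0 S = S - S0"

definition pull_set :: "nat \<Rightarrow> ('v, 'e) wgraph \<Rightarrow> 'e set \<Rightarrow> 'e set" where
  "pull_set b G T = (if b = 0 then T \<union> bridges (delete G T) else T)"

text \<open>
  The class of the restriction must not depend on the representative \<open>X\<close>: it is described by
  \<open>THE\<close>, which is unspecified unless a suitable \<open>X\<close> exists and all suitable \<open>X\<close> give the same
  class. For \<open>b = 1\<close>, the set \<open>bioriented X\<close> is a singleton whenever the graph has an edge.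
\<close>

definition push_class :: "nat \<Rightarrow> ('v, 'e) wgraph \<Rightarrow> 'e set \<Rightarrow>
    'e set \<times> ('e \<times> bool) set set \<Rightarrow> 'e set \<times> ('e \<times> bool) set set" where
  "push_class b G S0 = (\<lambda>(S, C).
     let K = delete (contract G S0) (push_set S0 S) in
       (push_set S0 S,
        if b = 1 \<and> edges (delete G S) \<subseteq> S0 then orient_equiv b K `` {{}}
        else THE D. \<exists>X\<in>C. (b = 1 \<longrightarrow> bioriented X \<inter> S0 = {}) \<and>
               D = orient_equiv b K `` {restrict_orientation X K}))"

end

theory Submission
  imports Defs
begin

text \<open>
  Whether \<open>X\<close> is totally cyclic or rooted can be read off the target counts: the number of targets
  in \<open>Z\<close> minus the number of edges inside \<open>Z\<close> counts the half-edges of \<open>X\<close> entering \<open>Z\<close>, up to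
  the bioriented edge. Hence an orientation on \<open>G - S\<close> may be replaced by an equivalent one inside
  any orientation that extends it, which gives transitivity and monotonicity.

  Cuts of \<open>G/S\<^sub>0\<close> are the cuts of \<open>G\<close> without edges in \<open>S\<^sub>0\<close>, so orientations restrict. Conversely, an
  orientation on the contraction is lifted by biorienting all of \<open>S\<^sub>0\<close> and then dropping
  half-edges one by one. If neither half-edge of \<open>f\<close> can be dropped, uncrossing two tight sets
  shows that \<open>f\<close> is a bridge (\<open>b = 0\<close>) or yields a contradiction (\<open>b = 1\<close>).
\<close>

section \<open>Entering half-edges\<close>

text \<open>A bridge cannot be directed without leaving one of its sides unentered, so for
  \<open>b = 0\<close> the bridges of \<open>delete G T\<close> stay bioriented when half-edges are
  dropped and have to be removed afterwards. This is why \<open>pull_set\<close> adds them, and why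
  deleting bridges must be shown to create no new ones and to keep a cyclic orientation cyclic. For
  \<open>b = 1\<close> bridges do no harm, because only sets away from the bioriented edge have to
  be entered. There the obstacle is a bioriented edge inside \<open>S0\<close>, which restriction to
  the contraction would lose. It can be moved along a directed path to any edge, each step
  exchanging two half-edges at the same vertex, so a representative with bioriented edge outside
  \<open>S0\<close> exists unless all remaining edges are contracted. In that case the contraction
  has a single vertex, each of its deletions carries at most one class, and the image is determined
  by the deleted set alone. The choice of representative in \<open>push_class\<close> does not
  matter since a contracted edge that is not bioriented always contributes exactly one target over
  its vertex of the contraction.\<close>

definition enters :: "('e \<Rightarrow> bool \<Rightarrow> 'v) \<Rightarrow> ('e \<times> bool) set \<Rightarrow> 'v set \<Rightarrow> bool" where
  "enters \<epsilon> X Z \<longleftrightarrow> (\<exists>e i. (e, i) \<in> X \<and> \<epsilon> e i \<in> Z \<and> \<epsilon> e (\<not> i) \<notin> Z)"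

text \<open>\<open>enters (endpt G) (half_edges G) Z\<close> says that the cut of \<open>Z\<close>
  is nonempty; sets with empty cut must be exempt, as \<open>G\<close> may be disconnected. Entry
  into \<open>Z\<close> alone is asked for, since exit from \<open>Z\<close> is entry into the
  complement, which has the same cut. Any number of bioriented edges is allowed, because the lifts
  pass through such orientations.\<close>

definition cyclic :: "('v, 'e) wgraph \<Rightarrow> ('e \<times> bool) set \<Rightarrow> bool" where
  "cyclic G X \<longleftrightarrow>
     (\<forall>Z\<subseteq>verts G. enters (endpt G) (half_edges G) Z \<longrightarrow> enters (endpt G) X Z)"

text \<open>The condition in \<open>rooted\<close> after passing to complements. It expresses that
  every vertex can be reached from the ends of \<open>e\<close> along directed edges of
  \<open>X\<close>.\<close>

definition spans :: "('v, 'e) wgraph \<Rightarrow> ('e \<times> bool) set \<Rightarrow> 'e \<Rightarrow> bool" where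
  "spans G X e \<longleftrightarrow>
     (\<forall>Z\<subseteq>verts G. Z \<noteq> {} \<and> (\<forall>i. endpt G e i \<notin> Z) \<longrightarrow> enters (endpt G) X Z)"

lemma delete_simps [simp]:
  "verts (delete G S) = verts G" "edges (delete G S) = edges G - S"
  "endpt (delete G S) = endpt G" "weight (delete G S) = weight G"
  by (simp_all add: delete_def)

lemma delete_delete: "delete (delete G S) T = delete G (S \<union> T)"
  by (simp add: delete_def Diff_Diff_Int Un_commute set_diff_eq)

lemma delete_empty [simp]: "delete G {} = G"
  by (simp add: delete_def)

lemma mem_half_edges [simp]: "(e, i) \<in> half_edges G \<longleftrightarrow> e \<in> edges G"
  by (simp add: half_edges_def)

lemma mem_bioriented: "e \<in> bioriented X \<longleftrightarrow> (\<forall>i. (e, i) \<in> X)"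
  by (auto simp: bioriented_def all_bool_eq)

lemma bioriented_mono: "X \<subseteq> Y \<Longrightarrow> bioriented X \<subseteq> bioriented Y"
  by (auto simp: bioriented_def)

lemma enters_mono: "enters \<epsilon> X Z \<Longrightarrow> X \<subseteq> Y \<Longrightarrow> enters \<epsilon> Y Z"
  unfolding enters_def by blast

lemma entersI: "(e, i) \<in> X \<Longrightarrow> \<epsilon> e i \<in> Z \<Longrightarrow> \<epsilon> e (\<not> i) \<notin> Z \<Longrightarrow> enters \<epsilon> X Z"
  unfolding enters_def by blast

lemma enters_half_edges_iff:
  "enters \<epsilon> (half_edges G) Z \<longleftrightarrow> (\<exists>e\<in>edges G. \<exists>i. \<epsilon> e i \<in> Z \<and> \<epsilon> e (\<not> i) \<notin> Z)"
  by (auto simp: enters_def)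

lemma gen_orientation_subset: "gen_orientation G X \<Longrightarrow> X \<subseteq> half_edges G"
  by (simp add: gen_orientation_def)

lemma gen_orientation_edge: "gen_orientation G X \<Longrightarrow> (e, i) \<in> X \<Longrightarrow> e \<in> edges G"
  using gen_orientation_subset by fastforce

lemma gen_orientation_other:
  "gen_orientation G X \<Longrightarrow> e \<in> edges G \<Longrightarrow> (e, i) \<notin> X \<Longrightarrow> (e, \<not> i) \<in> X"
  by (cases i) (auto simp: gen_orientation_def ex_bool_eq)

context weighted_graph
begin

lemma weighted_graph_delete: "weighted_graph (delete G S)"
  by unfold_locales (auto simp: finite_verts finite_edges endpt_in_verts)

lemma finite_half_edges: "finite (half_edges G)"
  by (simp add: half_edges_def finite_edges)

lemma finite_orientation: "gen_orientation G X \<Longrightarrow> finite X"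
  using finite_half_edges finite_subset gen_orientation_subset by blast

lemma bioriented_subset_edges: "gen_orientation G X \<Longrightarrow> bioriented X \<subseteq> edges G"
  using gen_orientation_edge by (fastforce simp: bioriented_def)

lemma finite_bioriented: "gen_orientation G X \<Longrightarrow> finite (bioriented X)"
  using bioriented_subset_edges finite_edges finite_subset by blast

section \<open>Cuts and bridges in terms of half-edges\<close>

lemma mem_cut:
  "Z \<subseteq> verts G \<Longrightarrow> e \<in> cut G Z \<longleftrightarrow> e \<in> edges G \<and> (\<exists>i. endpt G e i \<in> Z \<and> endpt G e (\<not> i) \<notin> Z)"
  by (auto simp: cut_def endpt_in_verts)

lemma cut_complement: "Z \<subseteq> verts G \<Longrightarrow> cut G (verts G - Z) = cut G Z"
proof -
  assume Z: "Z \<subseteq> verts G"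
  have "e \<in> cut G (verts G - Z) \<longleftrightarrow> e \<in> cut G Z" for e
    unfolding mem_cut[OF Z] mem_cut[OF Diff_subset]
    using endpt_in_verts by auto
  then show ?thesis by blast
qed

lemma cut_nonempty_iff:
  "Z \<subseteq> verts G \<Longrightarrow> cut G Z \<noteq> {} \<longleftrightarrow> enters (endpt G) (half_edges G) Z"
  using mem_cut[of Z] by (auto simp: enters_half_edges_iff)

lemma target_in_cut_iff:
  assumes "Z \<subseteq> verts G" "gen_orientation G X"
  shows "(\<exists>e\<in>cut G Z. has_target_in G X e Z) \<longleftrightarrow> enters (endpt G) X Z"
proof
  assume "\<exists>e\<in>cut G Z. has_target_in G X e Z"
  then obtain e i j where e: "e \<in> edges G" "endpt G e i \<in> Z" "endpt G e (\<not> i) \<notin> Z"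
    "(e, j) \<in> X" "endpt G e j \<in> Z"
    using mem_cut[OF assms(1)] by (auto simp: has_target_in_def)
  then have "i = j" by (cases i; cases j) auto
  then show "enters (endpt G) X Z" using e by (auto intro: entersI)
next
  assume "enters (endpt G) X Z"
  then obtain e i where e: "(e, i) \<in> X" "endpt G e i \<in> Z" "endpt G e (\<not> i) \<notin> Z"
    unfolding enters_def by blast
  then have "e \<in> cut G Z"
    using mem_cut[OF assms(1)] gen_orientation_edge[OF assms(2)] by blast
  then show "\<exists>e\<in>cut G Z. has_target_in G X e Z"
    using e unfolding has_target_in_def by blast
qed

lemma enters_half_edges_complement:
  "Z \<subseteq> verts G \<Longrightarrow> enters (endpt G) (half_edges G) (verts G - Z) \<longleftrightarrow> enters (endpt G) (half_edges G) Z"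
  using cut_complement[of Z] cut_nonempty_iff[of Z] cut_nonempty_iff[OF Diff_subset, of Z] by simp

lemma totally_cyclic_iff:
  "totally_cyclic G X \<longleftrightarrow> gen_orientation G X \<and> bioriented X = {} \<and> cyclic G X"
proof (cases "gen_orientation G X")
  case True
  \<comment> \<open>A set with nonempty cut is automatically nonempty and proper, which absorbs the
    side conditions in \<open>totally_cyclic\<close>.\<close>
  have proper: "enters (endpt G) (half_edges G) Z \<Longrightarrow> Z \<noteq> {} \<and> Z \<noteq> verts G" for Z
    unfolding enters_half_edges_iff using endpt_in_verts by auto
  have "(\<forall>Z. Z \<noteq> {} \<and> Z \<subset> verts G \<and> cut G Z \<noteq> {} \<longrightarrow>
        (\<exists>e\<in>cut G Z. has_target_in G X e Z) \<and>
        (\<exists>e\<in>cut G Z. has_target_in G X e (verts G - Z))) \<longleftrightarrow>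
      (\<forall>Z. Z \<subseteq> verts G \<and> enters (endpt G) (half_edges G) Z \<longrightarrow>
        enters (endpt G) X Z \<and> enters (endpt G) X (verts G - Z))" (is "(\<forall>Z. ?l Z) \<longleftrightarrow> (\<forall>Z. ?r Z)")
  proof (rule iff_allI)
    fix Z
    show "?l Z \<longleftrightarrow> ?r Z"
    proof (cases "Z \<subseteq> verts G")
      case Z: True
      note complement = target_in_cut_iff[OF Diff_subset True, of Z, unfolded cut_complement[OF Z]]
      show ?thesis
        unfolding target_in_cut_iff[OF Z True] complement cut_nonempty_iff[OF Z]
        using proper[of Z] Z by auto
    qed auto
  qed
  also have "\<dots> \<longleftrightarrow> cyclic G X"
    unfolding cyclic_def using enters_half_edges_complement by blast
  finally show ?thesis
    using True finite_bioriented[OF True] by (simp add: totally_cyclic_def b_orientation_def)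
qed (simp add: totally_cyclic_def b_orientation_def)

lemma rooted_iff:
  "rooted G X \<longleftrightarrow> gen_orientation G X \<and> (\<exists>e. bioriented X = {e} \<and> spans G X e)"
proof (cases "gen_orientation G X \<and> card (bioriented X) = 1")
  case True
  then have gen: "gen_orientation G X" by simp
  from True obtain e where e: "bioriented X = {e}" using card_1_singletonE by blast
  then have eE: "e \<in> edges G" using bioriented_subset_edges[OF gen] by blast
  have "rooted G X \<longleftrightarrow> (\<forall>Z. Z \<subset> verts G \<and> (\<forall>i. endpt G e i \<in> Z) \<longrightarrow>
      enters (endpt G) X (verts G - Z))"
  proof -
    have "(\<exists>e'\<in>cut G Z. has_target_in G X e' (verts G - Z)) \<longleftrightarrow> enters (endpt G) X (verts G - Z)"
      if "Z \<subset> verts G" for Z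
      using target_in_cut_iff[OF Diff_subset gen, of Z] that cut_complement[of Z] by auto
    moreover have "e \<in> edges (induced G Z) \<longleftrightarrow> (\<forall>i. endpt G e i \<in> Z)" for Z
      using eE by (simp add: induced_def)
    moreover have "rooted G X \<longleftrightarrow> (\<forall>Z. Z \<subset> verts G \<and> e \<in> edges (induced G Z) \<longrightarrow>
        (\<exists>e'\<in>cut G Z. has_target_in G X e' (verts G - Z)))"
      using True e by (simp add: rooted_def b_orientation_def)
    ultimately show ?thesis by simp
  qed
  also have "\<dots> \<longleftrightarrow> spans G X e"
    unfolding spans_def
  proof (intro iffI allI impI)
    fix Z
    assume all: "\<forall>Z. Z \<subset> verts G \<and> (\<forall>i. endpt G e i \<in> Z) \<longrightarrow> enters (endpt G) X (verts G - Z)"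
      and Z: "Z \<subseteq> verts G" and avoid: "Z \<noteq> {} \<and> (\<forall>i. endpt G e i \<notin> Z)"
    have "verts G - Z \<subset> verts G" using Z avoid by blast
    moreover have "\<forall>i. endpt G e i \<in> verts G - Z" using avoid endpt_in_verts[OF eE] by simp
    ultimately have "enters (endpt G) X (verts G - (verts G - Z))"
      using all[rule_format, of "verts G - Z"] by simp
    then show "enters (endpt G) X Z" using Z by (simp add: double_diff)
  next
    fix Z
    assume all: "\<forall>Z\<subseteq>verts G. Z \<noteq> {} \<and> (\<forall>i. endpt G e i \<notin> Z) \<longrightarrow> enters (endpt G) X Z"
      and Z: "Z \<subset> verts G \<and> (\<forall>i. endpt G e i \<in> Z)"
    then have "verts G - Z \<noteq> {}" by blast
    then show "enters (endpt G) X (verts G - Z)"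
      using all[rule_format, of "verts G - Z"] Z by simp
  qed
  finally show ?thesis using gen e by simp
next
  case False
  then show ?thesis by (auto simp: rooted_def b_orientation_def)
qed

lemma mem_bridges:
  "e \<in> bridges G \<longleftrightarrow> e \<in> edges G \<and> (\<exists>Z\<subseteq>verts G. \<exists>i. endpt G e i \<in> Z \<and> endpt G e (\<not> i) \<notin> Z \<and>
     (\<forall>f\<in>edges G. \<forall>j. endpt G f j \<in> Z \<and> endpt G f (\<not> j) \<notin> Z \<longrightarrow> f = e))" (is "_ \<longleftrightarrow> ?r")
proof
  assume "e \<in> bridges G"
  then obtain Z where Z: "Z \<noteq> {}" "Z \<subset> verts G" "cut G Z = {e}" "e \<in> edges G"
    unfolding bridges_def by blast
  then have mem: "f \<in> cut G Z \<longleftrightarrow> f \<in> edges G \<and> (\<exists>i. endpt G f i \<in> Z \<and> endpt G f (\<not> i) \<notin> Z)" for f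
    using mem_cut[of Z] by blast
  then obtain i where "endpt G e i \<in> Z" "endpt G e (\<not> i) \<notin> Z"
    using Z(3) by blast
  moreover have "f = e" if "f \<in> edges G" "endpt G f j \<in> Z" "endpt G f (\<not> j) \<notin> Z" for f j
    using mem[of f] Z(3) that by blast
  ultimately show ?r using Z(2,4) by blast
next
  assume ?r
  then obtain Z i where Z: "Z \<subseteq> verts G" "endpt G e i \<in> Z" "endpt G e (\<not> i) \<notin> Z"  "e \<in> edges G"
     "\<forall>f\<in>edges G. \<forall>j. endpt G f j \<in> Z \<and> endpt G f (\<not> j) \<notin> Z \<longrightarrow> f = e" by blast
  then have "cut G Z = {e}" using mem_cut[OF Z(1)] by blast
  moreover have "Z \<noteq> {}" "Z \<subset> verts G" using Z(1-3) endpt_in_verts[OF Z(4)] by blast+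
  ultimately show "e \<in> bridges G" using Z(4) unfolding bridges_def by blast
qed

section \<open>Components and connectedness through cuts\<close>

abbreviation "adj \<equiv> {(endpt G e i, endpt G e (\<not> i)) | e i. e \<in> edges G}"

lemma equiv_reachable: "equiv (verts G) (reachable G)"
proof -
  have "sym adj"
  proof (rule symI)
    fix x y assume "(x, y) \<in> adj"
    then obtain e i where "e \<in> edges G" "x = endpt G e (\<not> \<not> i)" "y = endpt G e (\<not> i)" by auto
    then show "(y, x) \<in> adj" by blast
  qed
  then have "sym (adj\<^sup>*)" by (rule sym_rtrancl)
  then show ?thesis
    unfolding reachable_def equiv_def refl_on_def sym_def trans_def
    by (auto dest: rtrancl_trans)
qed

lemma reachable_closed:
  assumes "(v, w) \<in> reachable G" "\<not> enters (endpt G) (half_edges G) Z" "v \<in> Z"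
  shows "w \<in> Z"
proof -
  have "(v, w) \<in> adj\<^sup>*" using assms(1) by (auto simp: reachable_def)
  then show ?thesis
  proof (induction rule: rtrancl_induct)
    case (step x y)
    then show ?case using assms(2) unfolding enters_half_edges_iff by auto
  qed (use assms(3) in simp)
qed

lemma reachable_edge: "e \<in> edges G \<Longrightarrow> (endpt G e i, endpt G e j) \<in> reachable G"
proof (cases "i = j")
  case True
  assume "e \<in> edges G"
  then show ?thesis using True by (simp add: reachable_def endpt_in_verts)
next
  case False
  assume e: "e \<in> edges G"
  have "j = (\<not> i)" using False by auto
  then have "(endpt G e i, endpt G e j) \<in> adj" using e by blast
  then show ?thesis using e by (auto simp: reachable_def endpt_in_verts)
qed

text \<open>Cuts, unlike components, are easy to compare between \<open>G\<close> and a contraction.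
  For the converse, a class of \<open>reachable G\<close> has an empty cut, because an edge leaving
  it would lead to a vertex of the same class; so the class is all of
  \<open>verts G\<close>.\<close>

lemma connected_graph_iff:
  "connected_graph G \<longleftrightarrow> verts G \<noteq> {} \<and>
     (\<forall>Z\<subseteq>verts G. Z \<noteq> {} \<and> Z \<noteq> verts G \<longrightarrow> enters (endpt G) (half_edges G) Z)" (is "_ \<longleftrightarrow> ?r")
proof
  assume "connected_graph G"
  then obtain C where C: "verts G // reachable G = {C}"
    unfolding connected_graph_def components_def using card_1_singletonE by blast
  then have CV: "C = verts G" using Union_quotient[OF equiv_reachable] by simp
  have all: "(v, w) \<in> reachable G" if "v \<in> verts G" "w \<in> verts G" for v w
  proof -
    have "reachable G `` {v} = verts G" using C CV quotientI[OF that(1), of "reachable G"] by simp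
    then show ?thesis using that by blast
  qed
  have "verts G \<noteq> {}" using C by auto
  moreover have "enters (endpt G) (half_edges G) Z" if Z: "Z \<subseteq> verts G" "Z \<noteq> {}" "Z \<noteq> verts G" for Z
  proof -
    obtain v w where "v \<in> Z" "w \<in> verts G" "w \<notin> Z" using Z by auto
    then show ?thesis using reachable_closed all Z by blast
  qed
  ultimately show ?r by blast
next
  assume r: ?r
  have "reachable G `` {v} = verts G" if v: "v \<in> verts G" for v
  proof (rule ccontr)
    let ?R = "reachable G `` {v}"
    assume "?R \<noteq> verts G"
    moreover have "?R \<subseteq> verts G" by (auto simp: reachable_def)
    moreover have "v \<in> ?R" by (rule equiv_class_self[OF equiv_reachable v])
    ultimately have "enters (endpt G) (half_edges G) ?R" using r by blast
    then obtain e i where e: "e \<in> edges G" "(v, endpt G e i) \<in> reachable G"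
      "(v, endpt G e (\<not> i)) \<notin> reachable G"
      unfolding enters_half_edges_iff by auto
    have "trans (reachable G)" using equiv_reachable by (simp add: equiv_def)
    from transD[OF this e(2) reachable_edge[OF e(1)]] show False using e(3) by blast
  qed
  then have "verts G // reachable G = {verts G}" using r by (auto simp: quotient_def)
  then show "connected_graph G" by (simp add: connected_graph_def components_def)
qed

end

section \<open>Counting targets\<close>

lemma target_count_delete [simp]: "target_count (delete G S) = target_count G"
  by (simp add: target_count_def fun_eq_iff)

lemma all_bool_iff: "(\<forall>j. P j) \<longleftrightarrow> P i \<and> P (\<not> i)"
  by (cases i) (auto simp: all_bool_eq)

context weighted_graph
begin

text \<open>Each edge of \<open>I\<close> contributes one target, and a bioriented edge contributes
  a second one.\<close>

lemma card_targets_edges: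
  assumes "gen_orientation G X" "I \<subseteq> edges G"
  shows "card (X \<inter> I \<times> UNIV) = card I + card (bioriented X \<inter> I)"
proof -
  have fin: "finite I" using assms(2) finite_edges finite_subset by blast
  have "card {i. (e, i) \<in> X} = 1 + (if e \<in> bioriented X then 1 else 0)" if "e \<in> I" for e
  proof -
    have "e \<in> edges G" using that assms(2) by blast
    then obtain i where i: "(e, i) \<in> X" using assms(1) unfolding gen_orientation_def by blast
    show ?thesis
    proof (cases "(e, \<not> i) \<in> X")
      case True
      then have all: "(e, j) \<in> X" for j using i by (cases "j = i") auto
      then have "e \<in> bioriented X" by (simp add: mem_bioriented)
      then show ?thesis using all by (simp add: card_UNIV_bool)
    next
      case False
      then have "(e, j) \<in> X \<longleftrightarrow> j = i" for j using i by (cases "j = i") auto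
      then show ?thesis using False by (simp add: mem_bioriented)
    qed
  qed
  then have "(\<Sum>e\<in>I. card {i. (e, i) \<in> X}) = (\<Sum>e\<in>I. 1 + (if e \<in> bioriented X then 1 else 0))"
    by (intro sum.cong) auto
  also have "\<dots> = card I + (\<Sum>e\<in>I \<inter> bioriented X. 1)"
    unfolding sum.inter_restrict[OF fin] sum.distrib by simp
  finally have "(\<Sum>e\<in>I. card {i. (e, i) \<in> X}) = card I + card (bioriented X \<inter> I)"
    by (simp add: Int_commute)
  moreover have "X \<inter> I \<times> UNIV = Sigma I (\<lambda>e. {i. (e, i) \<in> X})" by auto
  ultimately show ?thesis using fin by simp
qed

lemma sum_target_count:
  assumes "gen_orientation G X" "finite Z"
  shows "(\<Sum>v\<in>Z. target_count G X v) = card {(e, i) \<in> X. endpt G e i \<in> Z}"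
proof -
  have "{(e, i) \<in> X. endpt G e i \<in> Z} = (\<Union>v\<in>Z. {(e, i). (e, i) \<in> X \<and> endpt G e i = v})" by auto
  moreover have "card \<dots> = (\<Sum>v\<in>Z. card {(e, i). (e, i) \<in> X \<and> endpt G e i = v})"
  proof (rule card_UN_disjoint[OF assms(2)])
    show "\<forall>v\<in>Z. finite {(e, i). (e, i) \<in> X \<and> endpt G e i = v}"
      by (auto intro: finite_subset[OF _ finite_orientation[OF assms(1)]])
  qed auto
  ultimately show ?thesis by (simp add: target_count_def)
qed

text \<open>Targets in \<open>Z\<close> on edges with both ends in \<open>Z\<close>, loops included,
  are counted by \<open>card_targets_edges\<close>; all others belong to half-edges entering
  \<open>Z\<close>.\<close>

lemma sum_target_count_eq:
  assumes "gen_orientation G X" "Z \<subseteq> verts G"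
  shows "(\<Sum>v\<in>Z. target_count G X v) =
    card {e \<in> edges G. \<forall>i. endpt G e i \<in> Z} + card (bioriented X \<inter> {e. \<forall>i. endpt G e i \<in> Z})
    + card {(e, i) \<in> X. endpt G e i \<in> Z \<and> endpt G e (\<not> i) \<notin> Z}"
proof -
  let ?I = "{e \<in> edges G. \<forall>i. endpt G e i \<in> Z}"
  let ?B = "{(e, i) \<in> X. endpt G e i \<in> Z \<and> endpt G e (\<not> i) \<notin> Z}"
  have "finite Z" using assms(2) finite_verts finite_subset by blast
  have inner: "(\<forall>j. endpt G e j \<in> Z) \<longleftrightarrow> endpt G e i \<in> Z \<and> endpt G e (\<not> i) \<in> Z" for e i
    by (rule all_bool_iff)
  have "{(e, i) \<in> X. endpt G e i \<in> Z} = X \<inter> ?I \<times> UNIV \<union> ?B"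
  proof (rule set_eqI, rule prod.induct)
    fix e i
    show "(e, i) \<in> {(e, i) \<in> X. endpt G e i \<in> Z} \<longleftrightarrow> (e, i) \<in> X \<inter> ?I \<times> UNIV \<union> ?B"
      using gen_orientation_edge[OF assms(1), of e i] inner[of e i] by auto
  qed
  moreover have "(X \<inter> ?I \<times> UNIV) \<inter> ?B = {}" by auto
  moreover have "finite X" by (rule finite_orientation[OF assms(1)])
  moreover from this have "finite ?B" by (rule rev_finite_subset) auto
  ultimately have "card {(e, i) \<in> X. endpt G e i \<in> Z} = card (X \<inter> ?I \<times> UNIV) + card ?B"
    by (simp add: card_Un_disjoint)
  moreover have "bioriented X \<inter> ?I = bioriented X \<inter> {e. \<forall>i. endpt G e i \<in> Z}"
    using bioriented_subset_edges[OF assms(1)] by blast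
  ultimately show ?thesis
    using card_targets_edges[OF assms(1), of ?I] sum_target_count[OF assms(1) \<open>finite Z\<close>] by simp
qed

lemma card_entering_pos_iff:
  assumes "gen_orientation G X"
  shows "0 < card {(e, i) \<in> X. endpt G e i \<in> Z \<and> endpt G e (\<not> i) \<notin> Z} \<longleftrightarrow> enters (endpt G) X Z"
proof -
  have "finite {(e, i) \<in> X. endpt G e i \<in> Z \<and> endpt G e (\<not> i) \<notin> Z}"
    by (rule finite_subset[OF _ finite_orientation[OF assms]]) auto
  then show ?thesis by (auto simp: card_gt_0_iff enters_def)
qed

lemma cyclic_invariant:
  assumes X: "gen_orientation G X" "bioriented X = {}" "cyclic G X"
    and Y: "gen_orientation G Y" "bioriented Y = {}"
    and eq: "\<And>v. v \<in> verts G \<Longrightarrow> target_count G X v = target_count G Y v"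
  shows "cyclic G Y"
  unfolding cyclic_def
proof (intro allI impI)
  fix Z assume Z: "Z \<subseteq> verts G" "enters (endpt G) (half_edges G) Z"
  have "(\<Sum>v\<in>Z. target_count G X v) = (\<Sum>v\<in>Z. target_count G Y v)"
    using eq Z(1) by (intro sum.cong) auto
  moreover have "enters (endpt G) X Z" using X(3) Z unfolding cyclic_def by blast
  ultimately show "enters (endpt G) Y Z"
    using sum_target_count_eq[OF X(1) Z(1)] sum_target_count_eq[OF Y(1) Z(1)] X(2) Y(2)
      card_entering_pos_iff[OF X(1), of Z] card_entering_pos_iff[OF Y(1), of Z] by simp
qed

text \<open>
  \<open>X\<close> spans from its bioriented edge iff every nonempty \<open>Z\<close> receives more targets than it has inner
  edges, a condition that only involves the target counts.
\<close>

lemma spans_invariant: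
  assumes X: "gen_orientation G X" "bioriented X = {e}" "spans G X e"
    and Y: "gen_orientation G Y" "bioriented Y = {f}"
    and eq: "\<And>v. v \<in> verts G \<Longrightarrow> target_count G X v = target_count G Y v"
  shows "spans G Y f"
  unfolding spans_def
proof (intro allI impI)
  fix Z assume Z: "Z \<subseteq> verts G" "Z \<noteq> {} \<and> (\<forall>i. endpt G f i \<notin> Z)"
  have "(\<Sum>v\<in>Z. target_count G X v) = (\<Sum>v\<in>Z. target_count G Y v)"
    using eq Z(1) by (intro sum.cong) auto
  \<comment> \<open>Three positions of \<open>e\<close>: inside \<open>Z\<close> it counts in the
    first term; away from \<open>Z\<close> it leaves the entry to the assumption that
    \<open>X\<close> spans; with one end in \<open>Z\<close> it enters \<open>Z\<close> itself,
    being bioriented.\<close>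
  moreover have "0 < card (bioriented X \<inter> {e. \<forall>i. endpt G e i \<in> Z})
     + card {(e, i) \<in> X. endpt G e i \<in> Z \<and> endpt G e (\<not> i) \<notin> Z}"
  proof (cases "\<forall>i. endpt G e i \<in> Z")
    case False
    have "enters (endpt G) X Z"
    proof (cases "\<forall>i. endpt G e i \<notin> Z")
      case True
      then show ?thesis using X(3) Z unfolding spans_def by blast
    next
      case inside: False
      then obtain i where i: "endpt G e i \<in> Z" by blast
      have "endpt G e (\<not> i) \<notin> Z"
      proof
        assume "endpt G e (\<not> i) \<in> Z"
        then have "endpt G e j \<in> Z" for j using i by (cases "j = i") auto
        then show False using False by blast
      qed
      moreover have "(e, i) \<in> X" using X(2) mem_bioriented[of e X] by simp
      ultimately show ?thesis using i by (auto intro: entersI)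
    qed
    then show ?thesis using card_entering_pos_iff[OF X(1), of Z] by simp
  qed (use X(2) in auto)
  \<comment> \<open>As \<open>f\<close> avoids \<open>Z\<close>, the whole surplus of
    \<open>Y\<close> must come from entering half-edges.\<close>
  moreover have "bioriented Y \<inter> {e. \<forall>i. endpt G e i \<in> Z} = {}" using Y(2) Z by auto
  ultimately show "enters (endpt G) Y Z"
    using sum_target_count_eq[OF X(1) Z(1)] sum_target_count_eq[OF Y(1) Z(1)]
      card_entering_pos_iff[OF Y(1), of Z] by simp
qed

end

section \<open>Orienting bioriented edges\<close>

lemma gen_orientation_remove:
  "gen_orientation G X \<Longrightarrow> f \<in> bioriented X \<Longrightarrow> gen_orientation G (X - {(f, i)})"
  unfolding gen_orientation_def mem_bioriented by auto (metis (full_types))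

lemma bioriented_remove: "bioriented (X - {(f, i)}) = bioriented X - {f}"
  by (cases i) (auto simp: bioriented_def)

text \<open>Supplies the tight sets for uncrossing: if dropping \<open>(f, i)\<close> takes away the
  last entry of \<open>Z\<close>, then \<open>(f, i)\<close> was its only entry.\<close>

lemma not_enters_remove:
  assumes "\<not> enters \<epsilon> (X - {(f, i)}) Z" "enters \<epsilon> X Z"
  shows "\<epsilon> f i \<in> Z" "\<epsilon> f (\<not> i) \<notin> Z"
    "\<And>e j. (e, j) \<in> X \<Longrightarrow> \<epsilon> e j \<in> Z \<Longrightarrow> \<epsilon> e (\<not> j) \<notin> Z \<Longrightarrow> e = f \<and> j = i"
  using assms unfolding enters_def by blast+

context weighted_graph
begin

text \<open>
  If neither direction of \<open>f\<close> is possible, let \<open>Z\<close> and \<open>W\<close> be sets that can only be entered through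
  the respective half-edge of \<open>f\<close>. Then \<open>Z \<inter> W\<close> and \<open>Z \<union> W\<close> are not entered at all, hence have
  empty cuts, so \<open>f\<close> is the only edge in the cut of \<open>Z - W\<close>.
\<close>

lemma cyclic_remove:
  assumes gen: "gen_orientation G X" and cyc: "cyclic G X"
    and f: "f \<in> edges G" "f \<notin> bridges G"
  shows "\<exists>i. cyclic G (X - {(f, i)})"
proof (rule ccontr)
  assume "\<nexists>i. cyclic G (X - {(f, i)})"
  then have neg: "\<not> cyclic G (X - {(f, i)})" for i by blast
  have "\<exists>Z\<subseteq>verts G. enters (endpt G) X Z \<and> \<not> enters (endpt G) (X - {(f, i)}) Z" for i
    using neg[of i] cyc unfolding cyclic_def by blast
  then obtain Z W where
    Z: "Z \<subseteq> verts G" "enters (endpt G) X Z" "\<not> enters (endpt G) (X - {(f, True)}) Z" and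
    W: "W \<subseteq> verts G" "enters (endpt G) X W" "\<not> enters (endpt G) (X - {(f, False)}) W"
    by metis
  note nZ = not_enters_remove[OF Z(3,2)] and nW = not_enters_remove[OF W(3,2)]
  have fT: "endpt G f True \<in> Z" "endpt G f True \<notin> W" using nZ(1) nW(2) by auto
  have fF: "endpt G f False \<in> W" "endpt G f False \<notin> Z" using nZ(2) nW(1) by auto
  \<comment> \<open>Whatever enters the intersection enters \<open>Z\<close> or \<open>W\<close>,
    hence is a half-edge of \<open>f\<close>; but \<open>f\<close> joins \<open>Z - W\<close> to
    \<open>W - Z\<close>. The same reasoning disposes of the union.\<close>
  have "\<not> enters (endpt G) X (Z \<inter> W)"
  proof
    assume "enters (endpt G) X (Z \<inter> W)"
    then obtain e j where e: "(e, j) \<in> X" "endpt G e j \<in> Z" "endpt G e j \<in> W"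
      "endpt G e (\<not> j) \<notin> Z \<or> endpt G e (\<not> j) \<notin> W"
      unfolding enters_def by auto
    then show False using nZ(3)[of e j] nW(3)[of e j] fT fF by (cases j) auto
  qed
  then have inter: "\<not> enters (endpt G) (half_edges G) (Z \<inter> W)"
    using cyc Z(1) unfolding cyclic_def by blast
  have "\<not> enters (endpt G) X (Z \<union> W)"
  proof
    assume "enters (endpt G) X (Z \<union> W)"
    then obtain e j where e: "(e, j) \<in> X" "endpt G e j \<in> Z \<or> endpt G e j \<in> W"
      "endpt G e (\<not> j) \<notin> Z" "endpt G e (\<not> j) \<notin> W"
      unfolding enters_def by auto
    then show False using nZ(3)[of e j] nW(3)[of e j] fT fF by (cases j) auto
  qed
  then have union: "\<not> enters (endpt G) (half_edges G) (Z \<union> W)"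
    using cyc Z(1) W(1) unfolding cyclic_def by blast
  \<comment> \<open>The cuts of intersection and union being empty, an edge leaving
    \<open>Z - W\<close> ends in \<open>W - Z\<close>. Whichever of its half-edges is in
    \<open>X\<close> enters \<open>Z\<close> or \<open>W\<close>, so tightness makes the edge equal
    to \<open>f\<close>.\<close>
  have only: "e = f" if e: "e \<in> edges G" "endpt G e j \<in> Z - W" "endpt G e (\<not> j) \<notin> Z - W" for e j
  proof (rule ccontr)
    assume "e \<noteq> f"
    have "\<not> (endpt G e (\<not> j) \<in> Z \<inter> W)"
    proof
      assume "endpt G e (\<not> j) \<in> Z \<inter> W"
      then show False using inter e entersI[of e "\<not> j" "half_edges G" "endpt G" "Z \<inter> W"] by auto
    qed
    moreover have "endpt G e (\<not> j) \<in> Z \<union> W"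
      using union e entersI[of e j "half_edges G" "endpt G" "Z \<union> W"] by auto
    ultimately have *: "endpt G e (\<not> j) \<in> W" "endpt G e (\<not> j) \<notin> Z" using e(3) by auto
    consider "(e, j) \<in> X" | "(e, \<not> j) \<in> X" using gen_orientation_other[OF gen e(1)] by blast
    then show False
      using nZ(3)[of e j] nW(3)[of e "\<not> j"] e(2) * \<open>e \<noteq> f\<close> by cases auto
  qed
  have "f \<in> bridges G"
    unfolding mem_bridges
  proof (intro conjI exI[of _ "Z - W"] exI[of _ True])
    show "\<forall>e\<in>edges G. \<forall>j. endpt G e j \<in> Z - W \<and> endpt G e (\<not> j) \<notin> Z - W \<longrightarrow> e = f"
      using only by blast
  qed (use f fT fF Z(1) in auto)
  then show False using f(2) by blast
qed

text \<open>Bridges stay bioriented of necessity, since each side of a bridge can only be entered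
  through the bridge. The set \<open>bridges G\<close> does not depend on the orientation, so the
  other bioriented edges can be directed one after the other.\<close>

lemma cyclic_reduce:
  assumes "gen_orientation G X" "cyclic G X"
  shows "\<exists>Y\<subseteq>X. gen_orientation G Y \<and> cyclic G Y \<and> bioriented Y \<subseteq> bridges G"
  using assms
proof (induction "card (bioriented X - bridges G)" arbitrary: X rule: less_induct)
  case less
  show ?case
  proof (cases "bioriented X \<subseteq> bridges G")
    case True
    then show ?thesis using less.prems by blast
  next
    case False
    then obtain f where f: "f \<in> bioriented X" "f \<notin> bridges G" by blast
    then have "f \<in> edges G" using bioriented_subset_edges less.prems(1) by blast
    then obtain i where i: "cyclic G (X - {(f, i)})" using cyclic_remove less.prems f(2) by blast
    have "card (bioriented (X - {(f, i)}) - bridges G) < card (bioriented X - bridges G)"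
      unfolding bioriented_remove
      by (rule psubset_card_mono) (use f finite_bioriented[OF less.prems(1)] in auto)
    from less.hyps[OF this gen_orientation_remove[OF less.prems(1) f(1)] i]
    show ?thesis by blast
  qed
qed

text \<open>Here the union of the tight sets decides: it still avoids \<open>e\<close>, so some
  half-edge enters it, which then enters \<open>Z\<close> or \<open>W\<close> and belongs to
  \<open>f\<close>; but both ends of \<open>f\<close> lie in the union. Bridges form no exception,
  as they can be directed away from \<open>e\<close>.\<close>

lemma spans_remove:
  assumes span: "spans G X e" and f: "f \<noteq> e"
  shows "\<exists>i. spans G (X - {(f, i)}) e"
proof (rule ccontr)
  assume "\<nexists>i. spans G (X - {(f, i)}) e"
  then have neg: "\<not> spans G (X - {(f, i)}) e" for i by blast
  have "\<exists>Z\<subseteq>verts G. (\<forall>i. endpt G e i \<notin> Z) \<and> enters (endpt G) X Z \<and> \<not> enters (endpt G) (X - {(f, i)}) Z" for i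
    using neg[of i] span unfolding spans_def by blast
  then obtain Z W where
    Z: "Z \<subseteq> verts G" "\<forall>i. endpt G e i \<notin> Z" "enters (endpt G) X Z" "\<not> enters (endpt G) (X - {(f, True)}) Z" and
    W: "W \<subseteq> verts G" "\<forall>i. endpt G e i \<notin> W" "enters (endpt G) X W" "\<not> enters (endpt G) (X - {(f, False)}) W"
    by metis
  note nZ = not_enters_remove[OF Z(4,3)] and nW = not_enters_remove[OF W(4,3)]
  have fT: "endpt G f True \<in> Z" "endpt G f True \<notin> W" using nZ(1) nW(2) by auto
  have fF: "endpt G f False \<in> W" "endpt G f False \<notin> Z" using nZ(2) nW(1) by auto
  have "enters (endpt G) X (Z \<union> W)"
    using span[unfolded spans_def, rule_format, of "Z \<union> W"] Z(1,2) W(1,2) fT by auto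
  then obtain g j where g: "(g, j) \<in> X" "endpt G g j \<in> Z \<or> endpt G g j \<in> W"
    "endpt G g (\<not> j) \<notin> Z" "endpt G g (\<not> j) \<notin> W"
    unfolding enters_def by auto
  then show False using nZ(3)[of g j] nW(3)[of g j] fT fF by (cases j) auto
qed

lemma spans_reduce:
  assumes "gen_orientation G X" "spans G X e" "e \<in> bioriented X"
  shows "\<exists>Y\<subseteq>X. gen_orientation G Y \<and> spans G Y e \<and> bioriented Y = {e}"
  using assms
proof (induction "card (bioriented X)" arbitrary: X rule: less_induct)
  case less
  show ?case
  proof (cases "bioriented X = {e}")
    case True
    then show ?thesis using less.prems by blast
  next
    case False
    then obtain f where f: "f \<in> bioriented X" "f \<noteq> e" using less.prems(3) by blast
    then obtain i where i: "spans G (X - {(f, i)}) e" using spans_remove less.prems(2) by blast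
    have "card (bioriented (X - {(f, i)})) < card (bioriented X)"
      unfolding bioriented_remove
      by (rule psubset_card_mono) (use f finite_bioriented[OF less.prems(1)] in auto)
    moreover have "e \<in> bioriented (X - {(f, i)})"
      unfolding bioriented_remove using f less.prems(3) by blast
    ultimately show ?thesis
      using less.hyps[OF _ gen_orientation_remove[OF less.prems(1) f(1)] i] by blast
  qed
qed

section \<open>Deleting bridges\<close>

lemma bridgesI:
  assumes "f \<in> edges G" "Z \<subseteq> verts G" "endpt G f i \<in> Z" "endpt G f (\<not> i) \<notin> Z"
    "\<And>g j. g \<in> edges G \<Longrightarrow> endpt G g j \<in> Z \<Longrightarrow> endpt G g (\<not> j) \<notin> Z \<Longrightarrow> g = f"
  shows "f \<in> bridges G"
  unfolding mem_bridges using assms by blast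

text \<open>
  For a bridge \<open>e\<close> with side \<open>W\<close>, the cut of \<open>Z\<close> without \<open>e\<close> is the disjoint union of the cuts of
  \<open>W - Z\<close> and \<open>Z - W\<close>.
\<close>

lemma bridge_cut_split:
  assumes Z: "Z \<subseteq> verts G" and W: "W \<subseteq> verts G"
    and e: "e \<in> edges G" "endpt G e i \<in> Z \<inter> W" "endpt G e (\<not> i) \<notin> Z \<union> W"
    and only: "\<And>f j. f \<in> edges G \<Longrightarrow> endpt G f j \<in> W \<Longrightarrow> endpt G f (\<not> j) \<notin> W \<Longrightarrow> f = e"
    and f: "f \<in> edges G" "f \<noteq> e"
  shows "endpt G f j \<in> Z \<and> endpt G f (\<not> j) \<notin> Z \<longleftrightarrow>
    endpt G f (\<not> j) \<in> W - Z \<and> endpt G f j \<notin> W - Z \<or>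
    endpt G f j \<in> Z - W \<and> endpt G f (\<not> j) \<notin> Z - W"
  using only[OF f(1), of j] only[OF f(1), of "\<not> j"] f(2) by auto

text \<open>Both sides of a bridge have the same cut, so the one containing a prescribed end may be
  chosen. This brings \<open>Z\<close> and \<open>W\<close> into the position that
  \<open>bridge_cut_split\<close> asks for.\<close>

lemma bridge_side:
  assumes "e \<in> bridges G" "e \<in> edges G" "endpt G e i \<in> Z" "endpt G e (\<not> i) \<notin> Z"
  obtains W where "W \<subseteq> verts G" "endpt G e i \<in> W" "endpt G e (\<not> i) \<notin> W"
    "\<And>f j. f \<in> edges G \<Longrightarrow> endpt G f j \<in> W \<Longrightarrow> endpt G f (\<not> j) \<notin> W \<Longrightarrow> f = e"
proof -
  obtain W j where W: "W \<subseteq> verts G" "endpt G e j \<in> W" "endpt G e (\<not> j) \<notin> W" and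
    only: "\<forall>f\<in>edges G. \<forall>j. endpt G f j \<in> W \<and> endpt G f (\<not> j) \<notin> W \<longrightarrow> f = e"
    using assms(1) unfolding mem_bridges by blast
  show thesis
  proof (cases "j = i")
    case True
    then show thesis using that[of W] W only by auto
  next
    case False
    then have j: "j = (\<not> i)" by auto
    have "f = e" if "f \<in> edges G" "endpt G f k \<in> verts G - W" "endpt G f (\<not> k) \<notin> verts G - W" for f k
      using only[rule_format, of f "\<not> k"] that endpt_in_verts[OF that(1)] by auto
    then show thesis using that[of "verts G - W"] W j endpt_in_verts[OF assms(2)] by auto
  qed
qed

text \<open>If the set \<open>Z\<close> that exhibits a bridge \<open>f\<close> of
  \<open>delete G {e}\<close> also separates the ends of \<open>e\<close>, it does not do so in
  \<open>G\<close>. With \<open>W\<close> the side of \<open>e\<close> meeting \<open>Z\<close> in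
  an end of \<open>e\<close>, neither \<open>W - Z\<close> nor \<open>Z - W\<close> separates the
  ends of \<open>e\<close>, and the one crossed by \<open>f\<close> exhibits \<open>f\<close> as a
  bridge of \<open>G\<close>.\<close>

lemma bridges_delete_bridge:
  assumes e: "e \<in> bridges G"
  shows "bridges (delete G {e}) = bridges G - {e}"
proof -
  interpret D: weighted_graph "delete G {e}" by (rule weighted_graph_delete)
  have eE: "e \<in> edges G" using e mem_bridges by blast
  show ?thesis
  proof (intro set_eqI iffI)
    fix f assume "f \<in> bridges (delete G {e})"
    then obtain Z i where f: "f \<in> edges G - {e}" and Z: "Z \<subseteq> verts G" "endpt G f i \<in> Z"
      "endpt G f (\<not> i) \<notin> Z" and
      all: "\<forall>g\<in>edges G - {e}. \<forall>j. endpt G g j \<in> Z \<and> endpt G g (\<not> j) \<notin> Z \<longrightarrow> g = f"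
      unfolding D.mem_bridges delete_simps by blast
    have f: "f \<in> edges G" "f \<noteq> e" using f by auto
    have only: "g = f" if "g \<in> edges G" "g \<noteq> e" "endpt G g j \<in> Z" "endpt G g (\<not> j) \<notin> Z" for g j
      using all[rule_format, of g j] that by simp
    have "f \<in> bridges G"
    proof (cases "\<exists>j. endpt G e j \<in> Z \<and> endpt G e (\<not> j) \<notin> Z")
      case False
      then have "g = f" if "g \<in> edges G" "endpt G g j \<in> Z" "endpt G g (\<not> j) \<notin> Z" for g j
        using only[OF that(1)] that by (cases "g = e") blast+
      then show ?thesis using f Z unfolding mem_bridges by blast
    next
      case True
      then obtain j where j: "endpt G e j \<in> Z" "endpt G e (\<not> j) \<notin> Z" by blast
      obtain W where W: "W \<subseteq> verts G" "endpt G e j \<in> W" "endpt G e (\<not> j) \<notin> W"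
        and onlyW: "\<And>f j. f \<in> edges G \<Longrightarrow> endpt G f j \<in> W \<Longrightarrow> endpt G f (\<not> j) \<notin> W \<Longrightarrow> f = e"
        using bridge_side[OF e eE j] by blast
      have split: "endpt G g k \<in> Z \<and> endpt G g (\<not> k) \<notin> Z \<longleftrightarrow>
          endpt G g (\<not> k) \<in> W - Z \<and> endpt G g k \<notin> W - Z \<or>
          endpt G g k \<in> Z - W \<and> endpt G g (\<not> k) \<notin> Z - W" if "g \<in> edges G" "g \<noteq> e" for g k
        by (rule bridge_cut_split[OF Z(1) W(1) eE _ _ onlyW that, of j]) (use j W in auto)
      have WZ: "g = f" if g: "g \<in> edges G" "endpt G g k \<in> W - Z" "endpt G g (\<not> k) \<notin> W - Z" for g k
      proof (cases "g = e")
        case True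
        then show ?thesis using g j W by (cases "k = j") auto
      next
        case False
        then show ?thesis using split[OF g(1) False, of "\<not> k"] only[OF g(1) False, of "\<not> k"] g by auto
      qed
      have ZW: "g = f" if g: "g \<in> edges G" "endpt G g k \<in> Z - W" "endpt G g (\<not> k) \<notin> Z - W" for g k
      proof (cases "g = e")
        case True
        then show ?thesis using g j W by (cases "k = j") auto
      next
        case False
        then show ?thesis using split[OF g(1) False, of k] only[OF g(1) False, of k] g by auto
      qed
      have sub: "W - Z \<subseteq> verts G" "Z - W \<subseteq> verts G" using Z(1) W(1) by auto
      from split[OF f, of i] Z
      have "endpt G f (\<not> i) \<in> W - Z \<and> endpt G f (\<not> \<not> i) \<notin> W - Z \<or>
          endpt G f i \<in> Z - W \<and> endpt G f (\<not> i) \<notin> Z - W" by simp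
      then show ?thesis
      proof (elim disjE conjE)
        assume "endpt G f (\<not> i) \<in> W - Z" "endpt G f (\<not> \<not> i) \<notin> W - Z"
        then show ?thesis by (rule bridgesI[OF f(1) sub(1)]) (rule WZ)
      next
        assume "endpt G f i \<in> Z - W" "endpt G f (\<not> i) \<notin> Z - W"
        then show ?thesis by (rule bridgesI[OF f(1) sub(2)]) (rule ZW)
      qed
    qed
    then show "f \<in> bridges G - {e}" using f by blast
  next
    fix f assume "f \<in> bridges G - {e}"
    then have br: "f \<in> bridges G" and "f \<noteq> e" by auto
    obtain Z i where f: "f \<in> edges G" and Z: "Z \<subseteq> verts G" "endpt G f i \<in> Z" "endpt G f (\<not> i) \<notin> Z" and
      only: "\<forall>g\<in>edges G. \<forall>j. endpt G g j \<in> Z \<and> endpt G g (\<not> j) \<notin> Z \<longrightarrow> g = f"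
      using br unfolding mem_bridges by blast
    have "g = f" if "g \<in> edges (delete G {e})" "endpt (delete G {e}) g j \<in> Z"
      "endpt (delete G {e}) g (\<not> j) \<notin> Z" for g j
      using only[rule_format, of g j] that by simp
    then show "f \<in> bridges (delete G {e})"
      by (rule D.bridgesI[rotated 4]) (use f \<open>f \<noteq> e\<close> Z in simp_all)
  qed
qed

text \<open>The danger is a set \<open>Z\<close> that \<open>X\<close> enters only through
  \<open>e\<close>. Replacing it by \<open>W - Z\<close> and \<open>Z - W\<close>, whose cuts avoid
  \<open>e\<close>, gives another entry of \<open>Z\<close>.\<close>

lemma cyclic_delete_bridge:
  assumes e: "e \<in> bridges G" and cyc: "cyclic G X" and X: "X \<subseteq> half_edges G"
  shows "cyclic (delete G {e}) (X - {e} \<times> UNIV)"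
  unfolding cyclic_def delete_simps
proof (intro allI impI)
  fix Z assume Z: "Z \<subseteq> verts G" and "enters (endpt G) (half_edges (delete G {e})) Z"
  then obtain f i where f: "f \<in> edges G" "f \<noteq> e" "endpt G f i \<in> Z" "endpt G f (\<not> i) \<notin> Z"
    unfolding enters_half_edges_iff by auto
  have eE: "e \<in> edges G" using e mem_bridges by blast
  show "enters (endpt G) (X - {e} \<times> UNIV) Z"
  proof (cases "\<exists>j. endpt G e j \<in> Z \<and> endpt G e (\<not> j) \<notin> Z")
    case False
    have "enters (endpt G) (half_edges G) Z" using f unfolding enters_half_edges_iff by blast
    then have "enters (endpt G) X Z" using cyc Z unfolding cyclic_def by blast
    then show ?thesis using False unfolding enters_def by blast
  next
    case True
    then obtain j where j: "endpt G e j \<in> Z" "endpt G e (\<not> j) \<notin> Z" by blast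
    obtain W where W: "W \<subseteq> verts G" "endpt G e j \<in> W" "endpt G e (\<not> j) \<notin> W"
      and onlyW: "\<And>f j. f \<in> edges G \<Longrightarrow> endpt G f j \<in> W \<Longrightarrow> endpt G f (\<not> j) \<notin> W \<Longrightarrow> f = e"
      using bridge_side[OF e eE j] by blast
    have split: "endpt G g k \<in> Z \<and> endpt G g (\<not> k) \<notin> Z \<longleftrightarrow>
          endpt G g (\<not> k) \<in> W - Z \<and> endpt G g k \<notin> W - Z \<or>
          endpt G g k \<in> Z - W \<and> endpt G g (\<not> k) \<notin> Z - W" if "g \<in> edges G" "g \<noteq> e" for g k
      by (rule bridge_cut_split[OF Z(1) W(1) eE _ _ onlyW that, of j]) (use j W in auto)
    have not_e: "g \<noteq> e" if "endpt G g k \<in> W - Z \<and> endpt G g (\<not> k) \<notin> W - Z \<or>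
          endpt G g k \<in> Z - W \<and> endpt G g (\<not> k) \<notin> Z - W" for g k
      using that j W by (cases "k = j") auto
    have sub: "W - Z \<subseteq> verts G" "Z - W \<subseteq> verts G" "verts G - (W - Z) \<subseteq> verts G" using Z W(1) by auto
    from split[OF f(1,2), of i] f
    have "endpt G f (\<not> i) \<in> W - Z \<and> endpt G f (\<not> \<not> i) \<notin> W - Z \<or>
        endpt G f i \<in> Z - W \<and> endpt G f (\<not> i) \<notin> Z - W" by simp
    then have "enters (endpt G) (half_edges G) (W - Z) \<or> enters (endpt G) (half_edges G) (Z - W)"
      using f(1) unfolding enters_half_edges_iff by blast
    then show ?thesis
    proof
      \<comment> \<open>By the splitting, a half-edge leaving \<open>W - Z\<close> enters
        \<open>Z\<close>; so cyclicity is applied to the complement of \<open>W - Z\<close>.\<close>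
      assume "enters (endpt G) (half_edges G) (W - Z)"
      then have "enters (endpt G) (half_edges G) (verts G - (W - Z))"
        using enters_half_edges_complement[OF sub(1)] by simp
      then have "enters (endpt G) X (verts G - (W - Z))"
        using cyc sub(3) unfolding cyclic_def by blast
      then obtain g k where g: "(g, k) \<in> X" "endpt G g k \<notin> W - Z" "endpt G g (\<not> k) \<in> W - Z"
        using X endpt_in_verts unfolding enters_def by fastforce
      have "g \<in> edges G" using X g(1) by auto
      moreover have "g \<noteq> e" using not_e[of g "\<not> k"] g by auto
      ultimately have "endpt G g k \<in> Z \<and> endpt G g (\<not> k) \<notin> Z" using split[of g k] g by blast
      then show ?thesis using g(1) \<open>g \<noteq> e\<close> by (auto simp: enters_def)
    next
      assume "enters (endpt G) (half_edges G) (Z - W)"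
      then have "enters (endpt G) X (Z - W)" using cyc sub(2) unfolding cyclic_def by blast
      then obtain g k where g: "(g, k) \<in> X" "endpt G g k \<in> Z - W" "endpt G g (\<not> k) \<notin> Z - W"
        unfolding enters_def by blast
      have "g \<in> edges G" using X g(1) by auto
      moreover have "g \<noteq> e" using not_e[of g k] g by blast
      ultimately have "endpt G g k \<in> Z \<and> endpt G g (\<not> k) \<notin> Z" using split[of g k] g by blast
      then show ?thesis using g(1) \<open>g \<noteq> e\<close> by (auto simp: enters_def)
    qed
  qed
qed

lemma delete_bridges:
  assumes "finite B" "B \<subseteq> bridges G"
  shows "bridges (delete G B) = bridges G - B"
    and "X \<subseteq> half_edges G \<Longrightarrow> cyclic G X \<Longrightarrow> cyclic (delete G B) (X - B \<times> UNIV)"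
proof -
  have "bridges (delete G B) = bridges G - B \<and>
    (X \<subseteq> half_edges G \<longrightarrow> cyclic G X \<longrightarrow> cyclic (delete G B) (X - B \<times> UNIV))"
    using assms
  proof (induction B rule: finite_induct)
    case empty
    then show ?case by simp
  next
    case (insert e B)
    interpret D: weighted_graph "delete G B" by (rule weighted_graph_delete)
    have IH: "bridges (delete G B) = bridges G - B"
      "X \<subseteq> half_edges G \<Longrightarrow> cyclic G X \<Longrightarrow> cyclic (delete G B) (X - B \<times> UNIV)"
      using insert by auto
    have e: "e \<in> bridges (delete G B)" using IH(1) insert by auto
    have del: "delete (delete G B) {e} = delete G (insert e B)" by (simp add: delete_delete)
    have "bridges (delete G (insert e B)) = bridges G - insert e B"
      using D.bridges_delete_bridge[OF e] IH(1) unfolding del by auto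
    moreover have "cyclic (delete G (insert e B)) (X - insert e B \<times> UNIV)"
      if X: "X \<subseteq> half_edges G" "cyclic G X"
    proof -
      have "X - B \<times> UNIV \<subseteq> half_edges (delete G B)" using X(1) by (auto simp: half_edges_def)
      from D.cyclic_delete_bridge[OF e IH(2)[OF X] this]
      have "cyclic (delete G (insert e B)) (X - B \<times> UNIV - {e} \<times> UNIV)" unfolding del .
      moreover have "X - B \<times> UNIV - {e} \<times> UNIV = X - insert e B \<times> UNIV" by auto
      ultimately show ?thesis by simp
    qed
    ultimately show ?case by blast
  qed
  then show "bridges (delete G B) = bridges G - B"
    and "X \<subseteq> half_edges G \<Longrightarrow> cyclic G X \<Longrightarrow> cyclic (delete G B) (X - B \<times> UNIV)" by blast+
qed

text \<open>The cut that exhibits a bridge can only shrink when further edges are deleted. This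
  makes \<open>pull_set\<close> monotone for \<open>b = 0\<close>.\<close>

lemma bridges_delete_mono:
  assumes "T \<subseteq> S"
  shows "bridges (delete G T) - S \<subseteq> bridges (delete G S)"
proof
  interpret S: weighted_graph "delete G S" by (rule weighted_graph_delete)
  interpret T: weighted_graph "delete G T" by (rule weighted_graph_delete)
  fix e assume e: "e \<in> bridges (delete G T) - S"
  then have "e \<in> bridges (delete G T)" by blast
  then obtain Z i where eE: "e \<in> edges G - T" and Z: "Z \<subseteq> verts G" "endpt G e i \<in> Z" "endpt G e (\<not> i) \<notin> Z"
    and only: "\<forall>f\<in>edges G - T. \<forall>j. endpt G f j \<in> Z \<and> endpt G f (\<not> j) \<notin> Z \<longrightarrow> f = e"
    unfolding T.mem_bridges delete_simps by blast
  show "e \<in> bridges (delete G S)"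
  proof (rule S.bridgesI)
    fix f j assume "f \<in> edges (delete G S)" "endpt (delete G S) f j \<in> Z" "endpt (delete G S) f (\<not> j) \<notin> Z"
    then show "f = e" using only[rule_format, of f j] assms by auto
  qed (use e eE Z in auto)
qed

section \<open>Moving the bioriented edge\<close>

text \<open>The elementary move: \<open>e\<close> keeps its other half-edge and \<open>f\<close>
  already has its other one, so the second direction passes from \<open>e\<close> to
  \<open>f\<close>. The counts do not change because the exchanged half-edges have the same
  end.\<close>

lemma shift_bioriented:
  assumes X: "gen_orientation G X" "bioriented X = {e}"
    and f: "f \<in> edges G" "(f, j) \<notin> X" "endpt G f j = endpt G e i"
  defines "Y \<equiv> insert (f, j) (X - {(e, i)})"
  shows "gen_orientation G Y" "bioriented Y = {f}" "target_count G Y = target_count G X"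
proof -
  have e: "(e, k) \<in> X" for k using X(2) mem_bioriented[of e X] by simp
  have fe: "f \<noteq> e" using f(2) e by auto
  have fj: "(f, \<not> j) \<in> X" using gen_orientation_other[OF X(1) f(1,2)] .
  have "gen_orientation G (X - {(e, i)})" using gen_orientation_remove[OF X(1)] X(2) by blast
  then show "gen_orientation G Y"
    using f(1) unfolding Y_def gen_orientation_def by auto
  have "h \<in> bioriented Y \<longleftrightarrow> h = f" for h
  proof (cases "h = f")
    case True
    then show ?thesis using fj fe unfolding mem_bioriented all_bool_iff[of _ j] Y_def by auto
  next
    case False
    then have "h \<in> bioriented Y \<longleftrightarrow> h \<in> bioriented (X - {(e, i)})"
      unfolding mem_bioriented Y_def by auto
    then show ?thesis using X(2) False unfolding bioriented_remove by auto
  qed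
  then show "bioriented Y = {f}" by blast
  show "target_count G Y = target_count G X"
  proof
    fix v
    let ?T = "\<lambda>X. {(h, k). (h, k) \<in> X \<and> endpt G h k = v}"
    have fin: "finite (?T X)"
      by (rule finite_subset[OF _ finite_orientation[OF X(1)]]) auto
    show "target_count G Y v = target_count G X v"
    proof (cases "endpt G e i = v")
      case True
      then have "?T Y = insert (f, j) (?T X - {(e, i)})" using f(3) by (auto simp: Y_def)
      also have "card \<dots> = Suc (card (?T X - {(e, i)}))"
        by (rule card_insert_disjoint) (use fin f(2) in auto)
      also have "\<dots> = card (?T X)" by (rule card_Suc_Diff1[OF fin]) (use True e in auto)
      finally show ?thesis by (simp add: target_count_def)
    next
      case False
      have "(h, k) \<in> Y \<longleftrightarrow> (h, k) \<in> X" if "endpt G h k = v" for h k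
      proof -
        have "(h, k) \<noteq> (e, i)" "(h, k) \<noteq> (f, j)" using that False f(3) by (metis prod.inject)+
        then show ?thesis unfolding Y_def by blast
      qed
      then have "?T Y = ?T X" by auto
      then show ?thesis by (simp add: target_count_def)
    qed
  qed
qed

text \<open>
  Shifting along a directed path from \<open>e\<close> to the source of \<open>f\<close>. The set \<open>Z\<close> collects the vertices
  reached so far; the orientation obtained at any of them agrees with \<open>X\<close> on all edges not inside
  \<open>Z\<close>, so the step leaving \<open>Z\<close> can be taken in \<open>X\<close>.
\<close>

lemma shift_towards:
  assumes X: "gen_orientation G X" "bioriented X = {e}" "spans G X e"
    and f: "f \<in> edges G" "(f, j) \<notin> X"
    and Z: "Z \<subseteq> verts G" "\<And>i. endpt G e i \<in> Z" "endpt G f j \<notin> Z"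
    and reached: "\<And>u. u \<in> Z \<Longrightarrow> \<exists>Y g k. gen_orientation G Y \<and> bioriented Y = {g} \<and> endpt G g k = u \<and>
       target_count G Y = target_count G X \<and>
       (\<forall>h l. (\<exists>m. endpt G h m \<notin> Z) \<longrightarrow> ((h, l) \<in> Y \<longleftrightarrow> (h, l) \<in> X))"
  shows "\<exists>Y g k. gen_orientation G Y \<and> bioriented Y = {g} \<and> endpt G g k = endpt G f j \<and>
       target_count G Y = target_count G X \<and> (f, j) \<notin> Y"
  using Z reached
proof (induction "card (verts G - Z)" arbitrary: Z rule: less_induct)
  case less
  note Z = less.prems(1-3) and reached = less.prems(4)
  \<comment> \<open>The complement of \<open>Z\<close> contains the tail of \<open>f\<close> and
    avoids \<open>e\<close>, so an edge \<open>h\<close> of \<open>X\<close> leads out of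
    \<open>Z\<close>. Bringing the bioriented edge to the tail of \<open>h\<close> and then onto
    \<open>h\<close> makes it available at the head of \<open>h\<close>.\<close>
  have "verts G - Z \<noteq> {}" using endpt_in_verts[OF f(1)] Z(3) by blast
  then have "enters (endpt G) X (verts G - Z)"
    using X(3)[unfolded spans_def, rule_format, of "verts G - Z"] Z(2) by auto
  then obtain h l where h: "(h, l) \<in> X" "endpt G h l \<in> verts G - Z" "endpt G h (\<not> l) \<notin> verts G - Z"
    unfolding enters_def by blast
  have hE: "h \<in> edges G" using gen_orientation_edge[OF X(1) h(1)] .
  have hu: "endpt G h (\<not> l) \<in> Z" using h(3) endpt_in_verts[OF hE] by auto
  obtain Y g k where Y: "gen_orientation G Y" "bioriented Y = {g}" "endpt G g k = endpt G h (\<not> l)"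
    "target_count G Y = target_count G X"
    and agree: "\<And>h l m. endpt G h m \<notin> Z \<Longrightarrow> (h, l) \<in> Y \<longleftrightarrow> (h, l) \<in> X"
    using reached[OF hu] by blast
  have "h \<noteq> e" using h(2) Z(2) by auto
  then have "h \<notin> bioriented X" using X(2) by auto
  then have "(h, \<not> l) \<notin> X" using h(1) unfolding mem_bioriented all_bool_iff[of _ l] by blast
  then have hY: "(h, \<not> l) \<notin> Y" using agree[of h l] h(2) by simp
  \<comment> \<open>On edges not inside \<open>Z\<close>, \<open>Y\<close> agrees with
    \<open>X\<close>, whose only bioriented edge lies inside \<open>Z\<close>. Hence the shift from
    \<open>g\<close> to \<open>h\<close> alters, among the edges not inside \<open>Z\<close>, only
    \<open>h\<close>.\<close>
  have g: "endpt G g m \<in> Z" for m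
  proof (rule ccontr)
    assume "endpt G g m \<notin> Z"
    then have "g \<in> bioriented X" using agree[of g m] Y(2) unfolding mem_bioriented[of g] by (metis mem_bioriented singletonI)
    then show False using X(2) Z(2) \<open>endpt G g m \<notin> Z\<close> by auto
  qed
  let ?Y = "insert (h, \<not> l) (Y - {(g, k)})"
  note shift = shift_bioriented[OF Y(1,2) hE hY Y(3)[symmetric]]
  have agree': "(h', l') \<in> ?Y \<longleftrightarrow> (h', l') \<in> X" if "endpt G h' m \<notin> Z" "h' \<noteq> h" for h' l' m
    using agree[OF that(1), of l'] that g by auto
  show ?case
  proof (cases "endpt G h l = endpt G f j")
    case True
    \<comment> \<open>The half-edge just added has its end in \<open>Z\<close>, so
      \<open>(f, j)\<close> is still absent and the final shift onto \<open>f\<close> remains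
      possible.\<close>
    have "(f, j) \<noteq> (h, \<not> l)" using hu Z(3) by (metis prod.inject)
    then have "(f, j) \<notin> ?Y" using agree[OF Z(3), of j] f(2) by blast
    then show ?thesis using shift Y(4) True by metis
  next
    case False
    let ?Z = "insert (endpt G h l) Z"
    show ?thesis
    proof (rule less.hyps)
      show "card (verts G - ?Z) < card (verts G - Z)"
        by (rule psubset_card_mono) (use h(2) finite_verts in auto)
      show "?Z \<subseteq> verts G" using h(2) Z(1) by auto
      show "endpt G e i \<in> ?Z" for i using Z(2) by auto
      show "endpt G f j \<notin> ?Z" using False Z(3) by auto
      fix u assume u: "u \<in> ?Z"
      show "\<exists>Y g k. gen_orientation G Y \<and> bioriented Y = {g} \<and> endpt G g k = u \<and>
        target_count G Y = target_count G X \<and>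
        (\<forall>h l. (\<exists>m. endpt G h m \<notin> ?Z) \<longrightarrow> ((h, l) \<in> Y \<longleftrightarrow> (h, l) \<in> X))"
      proof (cases "u \<in> Z")
        case True
        from reached[OF this] show ?thesis by (elim ex_forward conj_forward) auto
      next
        case False
        \<comment> \<open>\<open>h\<close> has both ends in the enlarged set, so its change no
          longer affects the agreement required.\<close>
        have agree'': "(h', l') \<in> ?Y \<longleftrightarrow> (h', l') \<in> X" if "endpt G h' m \<notin> ?Z" for h' l' m
        proof (rule agree'[of h' m])
          show "h' \<noteq> h" using that hu by (cases "m = l") auto
        qed (use that in simp)
        show ?thesis
        proof (intro exI conjI allI impI)
          show "gen_orientation G ?Y" "bioriented ?Y = {h}" by (fact shift)+
          show "endpt G h l = u" using u False by simp
          show "target_count G ?Y = target_count G X" using shift(3) Y(4) by simp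
          show "(h', l') \<in> ?Y \<longleftrightarrow> (h', l') \<in> X" if "\<exists>m. endpt G h' m \<notin> ?Z" for h' l'
            using that agree'' by blast
        qed
      qed
    qed
  qed
qed

text \<open>A missing half-edge \<open>(f, j)\<close> marks the tail of \<open>f\<close>: once the
  bioriented edge has been brought there, one more shift puts it on \<open>f\<close>. This provides
  representatives whose bioriented edge is not contracted.\<close>

lemma move_bioriented:
  assumes X: "gen_orientation G X" "bioriented X = {e}" "spans G X e" and f: "f \<in> edges G"
  shows "\<exists>Y. gen_orientation G Y \<and> bioriented Y = {f} \<and> target_count G Y = target_count G X"
proof (cases "f = e")
  case False
  then obtain j where j: "(f, j) \<notin> X" using X(2) mem_bioriented[of f X] by auto
  have eE: "e \<in> edges G" using X bioriented_subset_edges by blast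
  have "\<exists>Y g k. gen_orientation G Y \<and> bioriented Y = {g} \<and> endpt G g k = endpt G f j \<and>
       target_count G Y = target_count G X \<and> (f, j) \<notin> Y"
  proof (cases "\<exists>i. endpt G e i = endpt G f j")
    case True
    then show ?thesis using X j by blast
  next
    case False
    \<comment> \<open>The search starts from the ends of \<open>e\<close>, where \<open>X\<close>
      itself is the required orientation.\<close>
    have Z: "range (endpt G e) \<subseteq> verts G" "\<And>i. endpt G e i \<in> range (endpt G e)"
      "endpt G f j \<notin> range (endpt G e)"
      using endpt_in_verts[OF eE] False by (auto simp: eq_commute)
    show ?thesis
      by (rule shift_towards[OF X f j Z]) (use X in auto)
  qed
  then obtain Y g k where Y: "gen_orientation G Y" "bioriented Y = {g}" "endpt G f j = endpt G g k"
    "target_count G Y = target_count G X" "(f, j) \<notin> Y" by metis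
  from shift_bioriented[OF Y(1,2) f Y(5,3)] Y(4) show ?thesis by metis
qed (use X in blast)

end

section \<open>Orientation classes\<close>

lemma restrict_orientation_subset: "restrict_orientation X G \<subseteq> X"
  by (auto simp: restrict_orientation_def)

lemma mem_restrict_orientation:
  "(e, i) \<in> restrict_orientation X G \<longleftrightarrow> (e, i) \<in> X \<and> e \<in> edges G"
  by (simp add: restrict_orientation_def)

lemma equiv_orient_equiv: "equiv (orientations b G) (orient_equiv b G)"
  by (rule equivI) (auto simp: orient_equiv_def refl_on_def sym_def trans_def)

lemma orient_equiv_orientations:
  assumes "(X, Y) \<in> orient_equiv b G"
  shows "X \<in> orientations b G" "Y \<in> orientations b G"
  using assms by (auto simp: orient_equiv_def)

lemma orientation_class_eq:
  assumes "C \<in> orientation_classes b G" "X \<in> C"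
  shows "C = orient_equiv b G `` {X}" "X \<in> orientations b G"
proof -
  have "C \<subseteq> orientations b G"
    using assms(1) in_quotient_imp_subset[OF equiv_orient_equiv] unfolding orientation_classes_def by blast
  then show "X \<in> orientations b G" using assms(2) by blast
  obtain Z where Z: "C = orient_equiv b G `` {Z}" "Z \<in> orientations b G"
    using assms(1) unfolding orientation_classes_def by (rule quotientE)
  then have "(Z, X) \<in> orient_equiv b G" using assms(2) by blast
  then show "C = orient_equiv b G `` {X}" using Z(1) equiv_class_eq[OF equiv_orient_equiv] by metis
qed

lemma orientation_class_mem:
  assumes "X \<in> orientations b G"
  shows "orient_equiv b G `` {X} \<in> orientation_classes b G" "X \<in> orient_equiv b G `` {X}"
  using assms quotientI equiv_class_self[OF equiv_orient_equiv]
  unfolding orientation_classes_def by fast+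

lemma orientation_class_nonempty:
  assumes "C \<in> orientation_classes b G"
  obtains X where "X \<in> C" "X \<in> orientations b G" "C = orient_equiv b G `` {X}"
proof -
  have "C \<noteq> {}"
    using in_quotient_imp_non_empty[OF equiv_orient_equiv] assms unfolding orientation_classes_def .
  then show thesis using that orientation_class_eq[OF assms] by blast
qed

lemma orient_equiv_class_cong:
  "(X, Y) \<in> orient_equiv b G \<Longrightarrow> orient_equiv b G `` {X} = orient_equiv b G `` {Y}"
  by (rule equiv_class_eq[OF equiv_orient_equiv])

section \<open>Equivalence of orientations and gluing\<close>

context weighted_graph
begin

lemma gen_orientation_edgeless: "edges G = {} \<Longrightarrow> gen_orientation G X \<longleftrightarrow> X = {}"
  by (auto simp: gen_orientation_def half_edges_def)

lemma orientations_0_iff: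
  "X \<in> orientations 0 G \<longleftrightarrow> gen_orientation G X \<and> bioriented X = {} \<and> cyclic G X"
  by (simp add: orientations_def totally_cyclic_iff)

lemma orientations_1_iff:
  "edges G \<noteq> {} \<Longrightarrow>
    X \<in> orientations 1 G \<longleftrightarrow> gen_orientation G X \<and> (\<exists>e. bioriented X = {e} \<and> spans G X e)"
  by (simp add: orientations_def rooted_iff)

lemma orientations_edgeless:
  assumes "edges G = {}" "X \<in> orientations b G" "b \<in> {0, 1}"
  shows "X = {}"
proof -
  have "\<not> rooted G X"
    using assms(1) bioriented_subset_edges unfolding rooted_iff by auto
  then show ?thesis
    using assms by (auto simp: orientations_0_iff gen_orientation_edgeless) (auto simp: orientations_def split: if_splits)
qed

lemma orientations_1_edgeless: "edges G = {} \<Longrightarrow> card (verts G) = 1 \<Longrightarrow> orientations 1 G = {{}}"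
  by (simp add: orientations_def)

lemma connected_edgeless:
  assumes "connected_graph G" "edges G = {}"
  shows "card (verts G) = 1"
proof -
  obtain v where v: "v \<in> verts G" using assms(1) connected_graph_iff by blast
  have "\<not> enters (endpt G) (half_edges G) {v}" using assms(2) by (simp add: enters_half_edges_iff)
  then have "{v} = verts G" using assms(1) v connected_graph_iff by blast
  then show ?thesis by (metis is_singletonI is_singleton_altdef)
qed

lemma orientations_gen:
  assumes "X \<in> orientations b G" "b \<in> {0, 1}"
  shows "gen_orientation G X"
proof (cases "edges G = {}")
  case True
  then show ?thesis using orientations_edgeless assms gen_orientation_edgeless by blast
next
  case False
  then show ?thesis using assms orientations_0_iff orientations_1_iff by blast
qed

lemma orientations_card:
  assumes "X \<in> orientations b G" "b \<in> {0, 1}" "edges G \<noteq> {}"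
  shows "card (bioriented X) = b"
  using assms orientations_0_iff[of X] orientations_1_iff[of X] by auto

lemma orientations_invariant:
  assumes b: "b \<in> {0, 1}" and X: "X \<in> orientations b G"
    and Y: "gen_orientation G Y" "card (bioriented Y) = b"
    and eq: "\<And>v. v \<in> verts G \<Longrightarrow> target_count G X v = target_count G Y v"
  shows "Y \<in> orientations b G"
proof (cases "b = 0")
  case True
  have "bioriented Y = {}" using Y finite_bioriented[OF Y(1)] True by simp
  then show ?thesis
    using X Y(1) cyclic_invariant[of X Y] eq unfolding True orientations_0_iff by blast
next
  case False
  then have b: "b = 1" using b by blast
  obtain f where f: "bioriented Y = {f}" using Y(2) b card_1_singletonE by blast
  then have "edges G \<noteq> {}" using bioriented_subset_edges[OF Y(1)] by blast
  note iff = orientations_1_iff[OF this]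
  obtain e where "gen_orientation G X" "bioriented X = {e}" "spans G X e"
    using X unfolding b iff by blast
  from spans_invariant[OF this Y(1) f eq] show ?thesis unfolding b iff using Y(1) f by blast
qed

lemma divisor_eq_iff:
  assumes "gen_orientation G X" "gen_orientation G Y"
  shows "divisor b G X = divisor b G Y \<longleftrightarrow> (\<forall>v\<in>verts G. target_count G X v = target_count G Y v)"
proof (cases "edges G = {}")
  case True
  then show ?thesis using assms by (simp add: gen_orientation_edgeless)
next
  case False
  have "divisor b G X = divisor b G Y \<longleftrightarrow> (\<forall>v\<in>verts G. divisor b G X v = divisor b G Y v)"
  proof
    assume all: "\<forall>v\<in>verts G. divisor b G X v = divisor b G Y v"
    show "divisor b G X = divisor b G Y"
    proof
      fix v show "divisor b G X v = divisor b G Y v"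
        using all by (cases "v \<in> verts G") (auto simp: divisor_def)
    qed
  qed simp
  then show ?thesis using False by (simp add: divisor_def)
qed

lemma orient_equivI:
  assumes "b \<in> {0, 1}" "X \<in> orientations b G" "gen_orientation G Y" "card (bioriented Y) = b"
    "\<And>v. v \<in> verts G \<Longrightarrow> target_count G X v = target_count G Y v"
  shows "(X, Y) \<in> orient_equiv b G"
  using orientations_invariant[OF assms] assms orientations_gen[OF assms(2,1)]
  unfolding orient_equiv_def by (simp add: divisor_eq_iff)

lemma orient_equiv_target_count:
  assumes "b \<in> {0, 1}" "(X, Y) \<in> orient_equiv b G" "v \<in> verts G"
  shows "target_count G X v = target_count G Y v"
  using assms divisor_eq_iff[of X Y b] orientations_gen[of _ b] unfolding orient_equiv_def by blast

text \<open>Target counts add up over \<open>delete G S\<close> and the remaining edges, so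
  exchanging the part on \<open>delete G S\<close> for an equivalent one keeps the class of
  \<open>W\<close>.\<close>

lemma glue_orientations:
  assumes b: "b \<in> {0, 1}" and W: "W \<in> orientations b (delete G T)" and TS: "T \<subseteq> S"
    and Y: "(restrict_orientation W (delete G S), Y) \<in> orient_equiv b (delete G S)"
  shows "\<exists>W'. (W, W') \<in> orient_equiv b (delete G T) \<and> restrict_orientation W' (delete G S) = Y"
proof -
  interpret S: weighted_graph "delete G S" by (rule weighted_graph_delete)
  interpret T: weighted_graph "delete G T" by (rule weighted_graph_delete)
  let ?X = "restrict_orientation W (delete G S)"
  have X: "?X \<in> orientations b (delete G S)" and Y': "Y \<in> orientations b (delete G S)"
    using orient_equiv_orientations[OF Y] by blast+
  note genX = S.orientations_gen[OF X b] and genY = S.orientations_gen[OF Y' b]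
    and genW = T.orientations_gen[OF W b]
  show ?thesis
  proof (cases "edges (delete G S) = {}")
    \<comment> \<open>Treated apart because for \<open>b = 1\<close> the empty orientation has no
      bioriented edge, and the comparison of cardinalities below would fail.\<close>
    case True
    then have "?X = Y" using S.orientations_edgeless[OF True _ b] X Y' by blast
    then show ?thesis using equiv_class_self[OF equiv_orient_equiv W] by blast
  next
    case False
    then have neT: "edges (delete G T) \<noteq> {}" using TS by auto
    let ?W = "W - half_edges (delete G S) \<union> Y"
    have restrict: "restrict_orientation ?W (delete G S) = Y"
      using gen_orientation_subset[OF genY] by (auto simp: restrict_orientation_def)
    have gen: "gen_orientation (delete G T) ?W"
      unfolding gen_orientation_def
    proof
      show "?W \<subseteq> half_edges (delete G T)"
        using gen_orientation_subset[OF genY] gen_orientation_subset[OF genW] TS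
        by (auto simp: half_edges_def)
      show "\<forall>e\<in>edges (delete G T). \<exists>i. (e, i) \<in> ?W"
      proof
        fix e assume e: "e \<in> edges (delete G T)"
        show "\<exists>i. (e, i) \<in> ?W"
        proof (cases "e \<in> edges (delete G S)")
          case True
          then show ?thesis using genY unfolding gen_orientation_def by blast
        next
          case False
          then show ?thesis using genW e unfolding gen_orientation_def by auto
        qed
      qed
    qed
    \<comment> \<open>Both have \<open>b\<close> bioriented edges, so none of those of
      \<open>W\<close> lies outside \<open>delete G S\<close>, and the glued orientation has exactly
      those of \<open>Y\<close>.\<close>
    have "bioriented ?X = bioriented W"
    proof (rule card_subset_eq[OF T.finite_bioriented[OF genW]])
      show "bioriented ?X \<subseteq> bioriented W" by (rule bioriented_mono[OF restrict_orientation_subset])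
      show "card (bioriented ?X) = card (bioriented W)"
        using S.orientations_card[OF X b False] T.orientations_card[OF W b neT] by simp
    qed
    then have "bioriented W \<subseteq> edges (delete G S)" using S.bioriented_subset_edges[OF genX] by simp
    then have "bioriented ?W = bioriented Y"
      using gen_orientation_edge[OF genY] by (auto simp: bioriented_def)
    then have card: "card (bioriented ?W) = b" using S.orientations_card[OF Y' b False] by simp
    have count: "target_count G W v = target_count G ?W v" if v: "v \<in> verts G" for v
    proof -
      let ?A = "\<lambda>X. {(e, i). (e, i) \<in> X \<and> endpt G e i = v}"
      have fin: "finite W" "finite Y" using T.finite_orientation[OF genW] S.finite_orientation[OF genY] by blast+
      have split: "card (?A (W - half_edges (delete G S) \<union> Z))
          = card (?A (W - half_edges (delete G S))) + card (?A Z)"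
        if Z: "gen_orientation (delete G S) Z" for Z
      proof -
        have "finite Z" by (rule S.finite_orientation[OF Z])
        have "card (?A (W - half_edges (delete G S)) \<union> ?A Z)
            = card (?A (W - half_edges (delete G S))) + card (?A Z)"
        proof (rule card_Un_disjoint)
          show "finite (?A (W - half_edges (delete G S)))"
            by (rule finite_subset[OF _ fin(1)]) auto
          show "finite (?A Z)" by (rule finite_subset[OF _ \<open>finite Z\<close>]) auto
          show "?A (W - half_edges (delete G S)) \<inter> ?A Z = {}"
            using gen_orientation_subset[OF Z] by auto
        qed
        moreover have "?A (W - half_edges (delete G S) \<union> Z) = ?A (W - half_edges (delete G S)) \<union> ?A Z" by auto
        ultimately show ?thesis by simp
      qed
      have "W = W - half_edges (delete G S) \<union> ?X" by (auto simp: restrict_orientation_def)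
      then have "card (?A W) = card (?A (W - half_edges (delete G S))) + card (?A ?X)"
        using split[OF genX] by simp
      moreover have "card (?A ?X) = card (?A Y)"
        using S.orient_equiv_target_count[OF b Y, of v] v by (simp add: target_count_def)
      ultimately show ?thesis using split[OF genY] by (simp add: target_count_def)
    qed
    have "(W, ?W) \<in> orient_equiv b (delete G T)"
      by (rule T.orient_equivI[OF b W gen card]) (use count in simp)
    then show ?thesis using restrict by blast
  qed
qed

section \<open>The order on orientation classes\<close>

lemma mem_OP:
  "(S, C) \<in> OP b G \<longleftrightarrow> S \<in> admissible_sets b G \<and> C \<in> orientation_classes b (delete G S)"
  by (simp add: OP_def)

lemma mem_OP_order:
  "((S, C), (T, D)) \<in> OP_order b G \<longleftrightarrow> (S, C) \<in> OP b G \<and> (T, D) \<in> OP b G \<and> T \<subseteq> S \<and>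
        (\<exists>X\<in>C. \<exists>Y\<in>D. restrict_orientation Y (delete G S) = X)"
  by (simp add: OP_order_def)

lemma restrict_orientation_id:
  "gen_orientation G X \<Longrightarrow> restrict_orientation X G = X"
  using gen_orientation_subset by (auto simp: restrict_orientation_def)

lemma partial_order_OP:
  assumes b: "b \<in> {0, 1}"
  shows "partial_order_on (OP b G) (OP_order b G)"
  unfolding partial_order_on_def preorder_on_def
proof (intro conjI)
  have id: "restrict_orientation X (delete G S) = X" if "X \<in> orientations b (delete G S)" for S X
  proof -
    interpret S: weighted_graph "delete G S" by (rule weighted_graph_delete)
    show ?thesis using S.restrict_orientation_id S.orientations_gen[OF that b] by blast
  qed
  show "OP_order b G \<subseteq> OP b G \<times> OP b G" by (auto simp: OP_order_def)
  show "refl_on (OP b G) (OP_order b G)"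
  proof (rule refl_onI)
    fix p assume p: "p \<in> OP b G"
    obtain S C where [simp]: "p = (S, C)" by fastforce
    have "C \<in> orientation_classes b (delete G S)" using p mem_OP by simp
    then obtain X where "X \<in> C" "X \<in> orientations b (delete G S)" by (rule orientation_class_nonempty)
    then show "(p, p) \<in> OP_order b G" using p id unfolding \<open>p = (S, C)\<close> mem_OP_order by blast
  qed
  show "antisym (OP_order b G)"
  proof (rule antisymI)
    fix p q assume pq: "(p, q) \<in> OP_order b G" "(q, p) \<in> OP_order b G"
    obtain S C T D where [simp]: "p = (S, C)" "q = (T, D)" by fastforce
    have "S = T" using pq by (auto simp: mem_OP_order)
    have CD: "C \<in> orientation_classes b (delete G S)" "D \<in> orientation_classes b (delete G S)"
      using pq(1) \<open>S = T\<close> by (auto simp: mem_OP_order mem_OP)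
    obtain X Y where "X \<in> C" "Y \<in> D" "restrict_orientation Y (delete G S) = X"
      using pq(1) by (auto simp: mem_OP_order)
    then have "X \<in> D" using id orientation_class_eq(2)[OF CD(2)] by metis
    then have "C = D" using \<open>X \<in> C\<close> orientation_class_eq(1) CD by metis
    then show "p = q" using \<open>S = T\<close> by simp
  qed
  show "trans (OP_order b G)"
  proof (rule transI)
    fix p q r assume pq: "(p, q) \<in> OP_order b G" and qr: "(q, r) \<in> OP_order b G"
    obtain S C T D U F where pqr: "p = (S, C)" "q = (T, D)" "r = (U, F)" by (metis prod.exhaust)
    obtain X Y where X: "X \<in> C" "Y \<in> D" "restrict_orientation Y (delete G S) = X"
      using pq unfolding pqr mem_OP_order by blast
    obtain Y' W where W: "Y' \<in> D" "W \<in> F" "restrict_orientation W (delete G T) = Y'"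
      using qr unfolding pqr mem_OP_order by blast
    have sub: "T \<subseteq> S" "U \<subseteq> T" using pq qr unfolding pqr mem_OP_order by auto
    have D: "D \<in> orientation_classes b (delete G T)" and F: "F \<in> orientation_classes b (delete G U)"
      using qr unfolding pqr mem_OP_order mem_OP by auto
    \<comment> \<open>The two comparisons meet in \<open>D\<close> with different representatives;
      gluing replaces \<open>W\<close> by an equivalent orientation restricting to
      \<open>Y\<close>.\<close>
    have "(restrict_orientation W (delete G T), Y) \<in> orient_equiv b (delete G T)"
      using X(2) W(1) orientation_class_eq(1)[OF D W(1)] unfolding W(3) by blast
    from glue_orientations[OF b orientation_class_eq(2)[OF F W(2)] sub(2) this]
    obtain W' where W': "(W, W') \<in> orient_equiv b (delete G U)" "restrict_orientation W' (delete G T) = Y"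
      by blast
    have "W' \<in> F" using W'(1) orientation_class_eq(1)[OF F W(2)] by blast
    moreover have "restrict_orientation W' (delete G S) = X"
      using W'(2) X(3) sub(1) by (auto simp: restrict_orientation_def half_edges_def)
    ultimately show "(p, r) \<in> OP_order b G"
      using pq qr sub X(1) unfolding pqr mem_OP_order by blast
  qed
qed

section \<open>Existence of rooted orientations and the one-vertex case\<close>

lemma spans_half_edges:
  assumes "e \<in> edges G" "connected_graph G"
  shows "spans G (half_edges G) e"
  unfolding spans_def
proof (intro allI impI)
  fix Z assume Z: "Z \<subseteq> verts G" "Z \<noteq> {} \<and> (\<forall>i. endpt G e i \<notin> Z)"
  then have "Z \<noteq> verts G" using endpt_in_verts[OF assms(1)] by metis
  then show "enters (endpt G) (half_edges G) Z" using assms(2) Z unfolding connected_graph_iff by simp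
qed

text \<open>With all edges bioriented a connected graph is spanned from any edge, and
  \<open>spans_reduce\<close> directs the others.\<close>

lemma orientations_1_nonempty:
  assumes "connected_graph G"
  shows "orientations 1 G \<noteq> {}"
proof (cases "edges G = {}")
  case True
  then show ?thesis
    using orientations_1_edgeless connected_edgeless[OF assms] by blast
next
  case False
  then obtain e where e: "e \<in> edges G" by blast
  have "gen_orientation G (half_edges G)" by (simp add: gen_orientation_def)
  moreover have "e \<in> bioriented (half_edges G)" using e by (simp add: mem_bioriented)
  ultimately show ?thesis
    using spans_reduce[OF _ spans_half_edges[OF e assms]] orientations_1_iff[OF False] by blast
qed

text \<open>All targets sit at the only vertex, so its count is \<open>card (edges G) + b\<close>
  for every orientation on a graph with edges.\<close>

lemma orient_equiv_single_vertex:
  assumes b: "b \<in> {0, 1}" and v: "card (verts G) = 1"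
    and XY: "X \<in> orientations b G" "Y \<in> orientations b G"
  shows "(X, Y) \<in> orient_equiv b G"
proof (cases "edges G = {}")
  case True
  then have "X = Y" using orientations_edgeless[OF True _ b] XY by blast
  then show ?thesis using XY by (simp add: orient_equiv_def)
next
  case False
  obtain v where v: "verts G = {v}" using v card_1_singletonE by blast
  have "target_count G Z v = card (edges G) + b" if Z: "Z \<in> orientations b G" for Z
  proof -
    have gen: "gen_orientation G Z" by (rule orientations_gen[OF Z b])
    have "{(e, i). (e, i) \<in> Z \<and> endpt G e i = v} = Z \<inter> edges G \<times> UNIV"
      using gen_orientation_edge[OF gen] endpt_in_verts v by auto
    moreover have "bioriented Z \<inter> edges G = bioriented Z" using bioriented_subset_edges[OF gen] by blast
    ultimately show ?thesis
      using card_targets_edges[OF gen order_refl] orientations_card[OF Z b False]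
      by (simp add: target_count_def)
  qed
  then show ?thesis
    using orient_equivI[OF b XY(1) orientations_gen[OF XY(2) b] orientations_card[OF XY(2) b False]] XY v
    by simp
qed

lemma orientation_class_unique:
  assumes b: "b \<in> {0, 1}" and v: "card (verts G) = 1"
    and CD: "C \<in> orientation_classes b G" "D \<in> orientation_classes b G"
  shows "C = D"
proof -
  obtain X where X: "X \<in> orientations b G" "C = orient_equiv b G `` {X}"
    using orientation_class_nonempty[OF CD(1)] .
  obtain Y where Y: "Y \<in> orientations b G" "D = orient_equiv b G `` {Y}"
    using orientation_class_nonempty[OF CD(2)] .
  show ?thesis
    unfolding X(2) Y(2) by (rule orient_equiv_class_cong[OF orient_equiv_single_vertex[OF b v X(1) Y(1)]])
qed

end

section \<open>Contraction\<close>

text \<open>A half-edge of \<open>Y\<close> missing from \<open>X\<close> would make its edge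
  bioriented in \<open>Y\<close> alone, since \<open>X\<close> must contain the other half-edge. It
  serves to show that dropping half-edges leaves the part of a lift on the contraction
  untouched.\<close>

lemma gen_orientation_eq:
  assumes "gen_orientation G X" "gen_orientation G Y" "X \<subseteq> Y" "bioriented X = bioriented Y"
  shows "X = Y"
proof
  show "Y \<subseteq> X"
  proof (rule subrelI)
    fix e i assume Y: "(e, i) \<in> Y"
    show "(e, i) \<in> X"
    proof (rule ccontr)
      assume "(e, i) \<notin> X"
      then have "(e, \<not> i) \<in> Y"
        using gen_orientation_other[OF assms(1) gen_orientation_edge[OF assms(2) Y]] assms(3) by blast
      then have "e \<in> bioriented X"
        using Y unfolding assms(4) mem_bioriented all_bool_iff[of _ i] by blast
      then show False using \<open>(e, i) \<notin> X\<close> unfolding mem_bioriented by blast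
    qed
  qed
qed (fact assms(3))

lemma bioriented_minus: "bioriented (X - B \<times> UNIV) = bioriented X - B"
  by (auto simp: bioriented_def)

lemma gen_orientation_delete:
  "gen_orientation G X \<Longrightarrow> gen_orientation (delete G B) (X - B \<times> UNIV)"
  unfolding gen_orientation_def by (auto simp: half_edges_def)

section \<open>Cuts of the contraction\<close>

locale contraction = weighted_graph G for G :: "('v, 'e) wgraph" +
  fixes S0 :: "'e set"
  assumes S0: "S0 \<subseteq> edges G"
begin

abbreviation H :: "('v set, 'e) wgraph" where "H \<equiv> contract G S0"

definition proj :: "'v \<Rightarrow> 'v set" where
  "proj v = reachable (G\<lparr>edges := edges G \<inter> S0\<rparr>) `` {v}"

text \<open>The dictionary between cuts: the sets \<open>preim Z\<close> are the unions of
  contracted classes, that is, the vertex sets crossed by no edge of \<open>S0\<close>.\<close>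

definition preim :: "'v set set \<Rightarrow> 'v set" where
  "preim Z = {v \<in> verts G. proj v \<in> Z}"

lemma contract_simps:
  "verts H = proj ` verts G" "edges H = edges G - S0" "endpt H e i = proj (endpt G e i)"
  by (auto simp: contract_def Let_def components_def proj_def quotient_def)

lemma weighted_graph_H: "weighted_graph H"
  by unfold_locales (auto simp: contract_simps finite_verts finite_edges endpt_in_verts)

sublocale K: weighted_graph "G\<lparr>edges := edges G \<inter> S0\<rparr>"
  by unfold_locales (auto simp: finite_verts finite_edges endpt_in_verts)

lemma proj_S0: "e \<in> S0 \<Longrightarrow> proj (endpt G e i) = proj (endpt G e j)"
  unfolding proj_def
  by (rule equiv_class_eq[OF K.equiv_reachable]) (use K.reachable_edge[of e i j] S0 in auto)

lemma preim_subset: "preim Z \<subseteq> verts G"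
  by (auto simp: preim_def)

lemma mem_preim: "e \<in> edges G \<Longrightarrow> endpt G e i \<in> preim Z \<longleftrightarrow> endpt H e i \<in> Z"
  by (simp add: preim_def contract_simps endpt_in_verts)

text \<open>A set crossed by no edge of \<open>S0\<close> is closed under \<open>reachable\<close>
  in the subgraph of contracted edges, hence a union of fibres of \<open>proj\<close>.\<close>

lemma preim_proj:
  assumes Z: "Z \<subseteq> verts G" "\<not> enters (endpt G) (S0 \<times> UNIV) Z"
  shows "preim (proj ` Z) = Z"
proof
  show "preim (proj ` Z) \<subseteq> Z"
  proof
    fix w assume "w \<in> preim (proj ` Z)"
    then obtain v where v: "v \<in> Z" "proj v = proj w" "w \<in> verts G" by (auto simp: preim_def)
    have "\<not> enters (endpt G) (half_edges (G\<lparr>edges := edges G \<inter> S0\<rparr>)) Z"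
      using Z(2) by (auto simp: enters_def)
    moreover have "(v, w) \<in> reachable (G\<lparr>edges := edges G \<inter> S0\<rparr>)"
      using eq_equiv_class[OF v(2)[unfolded proj_def] K.equiv_reachable] v(3) by simp
    ultimately show "w \<in> Z" using K.reachable_closed[of v w Z] v(1) by simp
  qed
qed (use Z(1) in \<open>auto simp: preim_def\<close>)

lemma not_enters_S0: "\<not> enters (endpt G) (S0 \<times> UNIV) (preim Z)"
proof
  assume "enters (endpt G) (S0 \<times> UNIV) (preim Z)"
  then obtain e i where e: "e \<in> S0" "endpt G e i \<in> preim Z" "endpt G e (\<not> i) \<notin> preim Z"
    by (auto simp: enters_def)
  then have "e \<in> edges G" using S0 by blast
  then show False using e proj_S0[OF e(1), of i "\<not> i"] by (simp add: mem_preim contract_simps(3))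
qed

lemma enters_H:
  "X \<subseteq> half_edges G \<Longrightarrow> enters (endpt H) X Z \<longleftrightarrow> enters (endpt G) X (preim Z)"
proof -
  assume X: "X \<subseteq> half_edges G"
  have "(e, i) \<in> X \<and> endpt H e i \<in> Z \<and> endpt H e (\<not> i) \<notin> Z \<longleftrightarrow>
      (e, i) \<in> X \<and> endpt G e i \<in> preim Z \<and> endpt G e (\<not> i) \<notin> preim Z" for e i
    using X mem_preim[of e _ Z] by (cases "(e, i) \<in> X") auto
  then show ?thesis unfolding enters_def by simp
qed

lemma enters_minus:
  assumes "\<not> enters \<epsilon> (S0 \<times> UNIV) Z"
  shows "enters \<epsilon> (X - S0 \<times> UNIV) Z \<longleftrightarrow> enters \<epsilon> X Z"
  using assms by (auto simp: enters_def)

lemma half_edges_delete_H: "half_edges (delete H (S - S0)) = half_edges (delete G S) - S0 \<times> UNIV"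
  by (auto simp: half_edges_def contract_simps)

lemma half_edges_delete_subset: "half_edges (delete G S) \<subseteq> half_edges G"
  by (auto simp: half_edges_def)

subsection \<open>Pushing forward\<close>

lemma gen_orientation_push:
  "gen_orientation (delete G S) X \<Longrightarrow> gen_orientation (delete H (S - S0)) (X - S0 \<times> UNIV)"
  unfolding gen_orientation_def half_edges_delete_H by (auto simp: contract_simps)

lemma restrict_orientation_push:
  "gen_orientation (delete G S) X \<Longrightarrow> restrict_orientation X (delete H (S - S0)) = X - S0 \<times> UNIV"
  using gen_orientation_subset[of "delete G S" X]
  by (auto simp: restrict_orientation_def half_edges_delete_H)

lemma enters_push:
  assumes "X \<subseteq> half_edges (delete G S)"
  shows "enters (endpt H) (X - S0 \<times> UNIV) Z \<longleftrightarrow> enters (endpt G) X (preim Z)"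
proof -
  have "X - S0 \<times> UNIV \<subseteq> half_edges G" using assms half_edges_delete_subset by blast
  from enters_H[OF this] show ?thesis by (simp add: enters_minus[OF not_enters_S0])
qed

lemma cyclic_push:
  assumes X: "gen_orientation (delete G S) X" "cyclic (delete G S) X"
  shows "cyclic (delete H (S - S0)) (X - S0 \<times> UNIV)"
  unfolding cyclic_def delete_simps
proof (intro allI impI)
  fix Z assume "enters (endpt H) (half_edges (delete H (S - S0))) Z"
  then have "enters (endpt G) (half_edges (delete G S)) (preim Z)"
    unfolding half_edges_delete_H enters_push[OF order_refl] .
  then have "enters (endpt G) X (preim Z)"
    using X(2)[unfolded cyclic_def, rule_format, of "preim Z"] preim_subset by simp
  then show "enters (endpt H) (X - S0 \<times> UNIV) Z"
    unfolding enters_push[OF gen_orientation_subset[OF X(1)]] .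
qed

lemma spans_push:
  assumes X: "gen_orientation (delete G S) X" "spans (delete G S) X e" and e: "e \<in> edges G"
  shows "spans (delete H (S - S0)) (X - S0 \<times> UNIV) e"
  unfolding spans_def delete_simps
proof (intro allI impI)
  fix Z assume Z: "Z \<subseteq> verts H" "Z \<noteq> {} \<and> (\<forall>i. endpt H e i \<notin> Z)"
  then have "preim Z \<noteq> {}" by (auto simp: preim_def contract_simps)
  then have "enters (endpt G) X (preim Z)"
    using X(2)[unfolded spans_def, rule_format, of "preim Z"] preim_subset Z(2) mem_preim[OF e] by simp
  then show "enters (endpt H) (X - S0 \<times> UNIV) Z"
    unfolding enters_push[OF gen_orientation_subset[OF X(1)]] .
qed

text \<open>Each contracted edge has exactly one target, which lies over the same vertex of \<open>H\<close> as its source.\<close>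

lemma target_count_push:
  assumes X: "gen_orientation (delete G S) X" "bioriented X \<inter> S0 = {}"
  shows "(\<Sum>v\<in>preim {C}. target_count G X v) =
    target_count H (X - S0 \<times> UNIV) C + card {e \<in> S0 - S. \<forall>i. endpt G e i \<in> preim {C}}"
proof -
  interpret S: weighted_graph "delete G S" by (rule weighted_graph_delete)
  let ?I = "{e \<in> S0 - S. \<forall>i. endpt G e i \<in> preim {C}}"
  let ?A = "{(e, i). (e, i) \<in> X - S0 \<times> UNIV \<and> endpt H e i = C}"
  have finX: "finite X" by (rule S.finite_orientation[OF X(1)])
  have finite: "finite (preim {C})" using finite_subset[OF preim_subset finite_verts] .
  have "(e, i) \<in> {(e, i) \<in> X. endpt G e i \<in> preim {C}} \<longleftrightarrow> (e, i) \<in> ?A \<union> X \<inter> ?I \<times> UNIV" for e i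
  proof (cases "(e, i) \<in> X")
    case True
    then have e: "e \<in> edges G" "e \<notin> S" using gen_orientation_edge[OF X(1) True] by auto
    show ?thesis
    proof (cases "e \<in> S0")
      case True
      then have "endpt G e j \<in> preim {C} \<longleftrightarrow> endpt G e i \<in> preim {C}" for j
        using mem_preim[OF e(1)] proj_S0[of e i j] by (simp add: contract_simps)
      then show ?thesis using \<open>(e, i) \<in> X\<close> True e by auto
    qed (use True mem_preim[OF e(1)] in auto)
  qed auto
  then have "{(e, i) \<in> X. endpt G e i \<in> preim {C}} = ?A \<union> X \<inter> ?I \<times> UNIV" by (simp add: set_eq_iff)
  moreover have "finite ?A" by (rule finite_subset[OF _ finX]) auto
  moreover have "?A \<inter> (X \<inter> ?I \<times> UNIV) = {}" by auto
  ultimately have "card {(e, i) \<in> X. endpt G e i \<in> preim {C}} = card ?A + card (X \<inter> ?I \<times> UNIV)"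
    using card_Un_disjoint[of ?A "X \<inter> ?I \<times> UNIV"] finX by simp
  moreover have "card (X \<inter> ?I \<times> UNIV) = card ?I + card (bioriented X \<inter> ?I)"
    by (rule S.card_targets_edges[OF X(1)]) (use S0 in auto)
  moreover have "bioriented X \<inter> ?I = {}" using X(2) by auto
  ultimately show ?thesis
    using S.sum_target_count[OF X(1) finite] by (simp add: target_count_def)
qed

lemma target_count_push_eq:
  assumes X: "gen_orientation (delete G S) X" "bioriented X \<inter> S0 = {}"
    and Y: "gen_orientation (delete G S) Y" "bioriented Y \<inter> S0 = {}"
    and eq: "\<And>v. v \<in> verts G \<Longrightarrow> target_count G X v = target_count G Y v"
  shows "target_count H (X - S0 \<times> UNIV) C = target_count H (Y - S0 \<times> UNIV) C"
proof -
  have "(\<Sum>v\<in>preim {C}. target_count G X v) = (\<Sum>v\<in>preim {C}. target_count G Y v)"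
    using eq preim_subset by (intro sum.cong) auto
  then show ?thesis using target_count_push[OF X] target_count_push[OF Y] by simp
qed

text \<open>If \<open>Z\<close> exhibits a bridge of the contraction, \<open>preim Z\<close>
  exhibits the same bridge before contraction, because no edge of \<open>S0\<close> crosses
  it.\<close>

lemma bridges_push:
  assumes "bridges (delete G S) = {}"
  shows "bridges (delete H (S - S0)) = {}"
proof (rule ccontr)
  interpret S: weighted_graph "delete G S" by (rule weighted_graph_delete)
  interpret H: weighted_graph "delete H (S - S0)"
    by (rule weighted_graph.weighted_graph_delete[OF weighted_graph_H])
  assume "bridges (delete H (S - S0)) \<noteq> {}"
  then obtain e where "e \<in> bridges (delete H (S - S0))" by blast
  then obtain Z i where e: "e \<in> edges (delete H (S - S0))" and Z: "Z \<subseteq> verts H"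
    "endpt H e i \<in> Z" "endpt H e (\<not> i) \<notin> Z" and
    only: "\<forall>f\<in>edges (delete H (S - S0)). \<forall>j. endpt H f j \<in> Z \<and> endpt H f (\<not> j) \<notin> Z \<longrightarrow> f = e"
    unfolding H.mem_bridges delete_simps by blast
  have eG: "e \<in> edges G" "e \<notin> S" "e \<notin> S0" using e by (auto simp: contract_simps)
  have "e \<in> bridges (delete G S)"
  proof (rule S.bridgesI)
    fix f j assume f: "f \<in> edges (delete G S)" "endpt (delete G S) f j \<in> preim Z"
      "endpt (delete G S) f (\<not> j) \<notin> preim Z"
    then have fG: "f \<in> edges G" "f \<notin> S" by auto
    have "f \<notin> S0" using not_enters_S0 f(2,3) entersI[of f j "S0 \<times> UNIV" "endpt G"] by auto
    then show "f = e" using only[rule_format, of f j] f fG by (simp add: mem_preim contract_simps(2))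
  qed (use eG Z preim_subset in \<open>simp_all add: mem_preim\<close>)
  then show False using assms by blast
qed

lemma connected_push:
  assumes "connected_graph (delete G S)"
  shows "connected_graph (delete H (S - S0))"
proof -
  interpret S: weighted_graph "delete G S" by (rule weighted_graph_delete)
  interpret H: weighted_graph "delete H (S - S0)"
    by (rule weighted_graph.weighted_graph_delete[OF weighted_graph_H])
  have conn: "verts G \<noteq> {}" "\<And>Z. Z \<subseteq> verts G \<Longrightarrow> Z \<noteq> {} \<Longrightarrow> Z \<noteq> verts G \<Longrightarrow>
      enters (endpt G) (half_edges (delete G S)) Z"
    using assms unfolding S.connected_graph_iff delete_simps by blast+
  show ?thesis
    unfolding H.connected_graph_iff delete_simps
  proof (intro conjI allI impI)
    show "verts H \<noteq> {}" using conn(1) by (simp add: contract_simps)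
    fix Z assume Z: "Z \<subseteq> verts H" "Z \<noteq> {} \<and> Z \<noteq> verts H"
    then have "preim Z \<noteq> {}" "preim Z \<noteq> verts G" by (auto simp: preim_def contract_simps)
    then show "enters (endpt H) (half_edges (delete H (S - S0))) Z"
      unfolding half_edges_delete_H enters_push[OF order_refl] using conn(2)[OF preim_subset] by blast
  qed
qed

lemma admissible_push:
  assumes "S \<in> admissible_sets b G"
  shows "S - S0 \<in> admissible_sets b H"
  using assms bridges_push connected_push
  by (auto simp: admissible_sets_def contract_simps split: if_splits)

lemma orientations_push:
  assumes b: "b \<in> {0, 1}" and X: "X \<in> orientations b (delete G S)" "bioriented X \<inter> S0 = {}"
    and edges: "\<not> (b = 1 \<and> edges (delete G S) \<subseteq> S0)"
  shows "X - S0 \<times> UNIV \<in> orientations b (delete H (S - S0))"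
proof -
  interpret S: weighted_graph "delete G S" by (rule weighted_graph_delete)
  interpret H: weighted_graph "delete H (S - S0)"
    by (rule weighted_graph.weighted_graph_delete[OF weighted_graph_H])
  have gen: "gen_orientation (delete G S) X" by (rule S.orientations_gen[OF X(1) b])
  note gen' = gen_orientation_push[OF gen]
  have "b = 0 \<or> b = 1" using b by blast
  then show ?thesis
  proof
    assume b: "b = 0"
    have "bioriented X = {}" "cyclic (delete G S) X" using X(1) unfolding b S.orientations_0_iff by auto
    then show ?thesis
      unfolding b H.orientations_0_iff using gen' cyclic_push[OF gen] by (simp add: bioriented_minus)
  next
    assume b: "b = 1"
    then have "edges (delete G S) \<noteq> {}" using edges by auto
    from S.orientations_1_iff[OF this, of X] X(1)
    obtain e where e: "bioriented X = {e}" "spans (delete G S) X e"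
      unfolding b by blast
    then have "e \<in> edges (delete G S)" using S.bioriented_subset_edges[OF gen] by blast
    then have eG: "e \<in> edges G" by simp
    have bio: "bioriented (X - S0 \<times> UNIV) = {e}" using e(1) X(2) by (auto simp: bioriented_minus)
    then have "edges (delete H (S - S0)) \<noteq> {}" using H.bioriented_subset_edges[OF gen'] by blast
    then show ?thesis
      unfolding b using H.orientations_1_iff gen' bio spans_push[OF gen e(2) eG] by blast
  qed
qed

lemma orient_equiv_push:
  assumes b: "b \<in> {0, 1}" and XY: "(X, Y) \<in> orient_equiv b (delete G S)"
    and X: "bioriented X \<inter> S0 = {}" and Y: "bioriented Y \<inter> S0 = {}"
    and edges: "\<not> (b = 1 \<and> edges (delete G S) \<subseteq> S0)"
  shows "(X - S0 \<times> UNIV, Y - S0 \<times> UNIV) \<in> orient_equiv b (delete H (S - S0))"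
proof -
  interpret S: weighted_graph "delete G S" by (rule weighted_graph_delete)
  interpret H: weighted_graph "delete H (S - S0)"
    by (rule weighted_graph.weighted_graph_delete[OF weighted_graph_H])
  note or = orient_equiv_orientations[OF XY]
  note gen = S.orientations_gen[OF or(1) b] S.orientations_gen[OF or(2) b]
  note push = orientations_push[OF b or(1) X edges] orientations_push[OF b or(2) Y edges]
  have "target_count G X v = target_count G Y v" if "v \<in> verts G" for v
    using S.orient_equiv_target_count[OF b XY, of v] that by simp
  then have "target_count H (X - S0 \<times> UNIV) C = target_count H (Y - S0 \<times> UNIV) C" for C
    by (rule target_count_push_eq[OF gen(1) X gen(2) Y])
  then show ?thesis
    using push H.divisor_eq_iff[OF gen_orientation_push[OF gen(1)] gen_orientation_push[OF gen(2)]]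
    unfolding orient_equiv_def by simp
qed

lemma push_class_edgeless:
  "edges (delete G S) \<subseteq> S0 \<Longrightarrow>
    push_class 1 G S0 (S, C) = (S - S0, orient_equiv 1 (delete H (S - S0)) `` {{}})"
  by (simp add: push_class_def push_set_def)

text \<open>Resolves the \<open>THE\<close> in \<open>push_class\<close>: by
  \<open>orient_equiv_push\<close>, all representatives without bioriented edge in \<open>S0\<close>
  restrict to the same class.\<close>

lemma push_class_eq:
  assumes b: "b \<in> {0, 1}" and C: "C \<in> orientation_classes b (delete G S)"
    and X: "X \<in> C" "bioriented X \<inter> S0 = {}"
    and edges: "\<not> (b = 1 \<and> edges (delete G S) \<subseteq> S0)"
  shows "push_class b G S0 (S, C) =
    (S - S0, orient_equiv b (delete H (S - S0)) `` {X - S0 \<times> UNIV})"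
proof -
  interpret S: weighted_graph "delete G S" by (rule weighted_graph_delete)
  let ?K = "delete H (S - S0)"
  have restrict: "restrict_orientation Y ?K = Y - S0 \<times> UNIV" if "Y \<in> C" for Y
    using restrict_orientation_push[OF S.orientations_gen[OF orientation_class_eq(2)[OF C that] b]] .
  have "(THE D. \<exists>X\<in>C. (b = 1 \<longrightarrow> bioriented X \<inter> S0 = {}) \<and>
          D = orient_equiv b ?K `` {restrict_orientation X ?K}) = orient_equiv b ?K `` {X - S0 \<times> UNIV}"
  proof (rule the_equality)
    show "\<exists>Y\<in>C. (b = 1 \<longrightarrow> bioriented Y \<inter> S0 = {}) \<and>
        orient_equiv b ?K `` {X - S0 \<times> UNIV} = orient_equiv b ?K `` {restrict_orientation Y ?K}"
      using X restrict by auto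
  next
    fix D assume "\<exists>Y\<in>C. (b = 1 \<longrightarrow> bioriented Y \<inter> S0 = {}) \<and>
          D = orient_equiv b ?K `` {restrict_orientation Y ?K}"
    then obtain Y where Y: "Y \<in> C" "b = 1 \<longrightarrow> bioriented Y \<inter> S0 = {}"
      "D = orient_equiv b ?K `` {Y - S0 \<times> UNIV}" using restrict by auto
    have "bioriented Y \<inter> S0 = {}"
    proof (cases "b = 0")
      case True
      then show ?thesis using orientation_class_eq(2)[OF C Y(1)] S.orientations_0_iff by blast
    qed (use Y(2) b in blast)
    moreover have "(Y, X) \<in> orient_equiv b (delete G S)"
      using orientation_class_eq(1)[OF C Y(1)] X(1) by blast
    ultimately show "D = orient_equiv b ?K `` {X - S0 \<times> UNIV}"
      unfolding Y(3) using orient_equiv_class_cong orient_equiv_push[OF b _ _ X(2) edges] by blast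
  qed
  then show ?thesis
    unfolding push_class_def push_set_def Let_def case_prod_conv if_not_P[OF edges] by (simp only:)
qed

text \<open>For \<open>b = 1\<close> some edge outside \<open>S0\<close> remains, and
  \<open>move_bioriented\<close> carries the bioriented edge to it within the class.\<close>

lemma representative_outside:
  assumes b: "b \<in> {0, 1}" and C: "C \<in> orientation_classes b (delete G S)"
    and edges: "\<not> (b = 1 \<and> edges (delete G S) \<subseteq> S0)"
  obtains X where "X \<in> C" "bioriented X \<inter> S0 = {}"
proof -
  interpret S: weighted_graph "delete G S" by (rule weighted_graph_delete)
  obtain X where X: "X \<in> C" "X \<in> orientations b (delete G S)" "C = orient_equiv b (delete G S) `` {X}"
    using orientation_class_nonempty[OF C] .
  show thesis
  proof (cases "b = 0")
    case True
    then show thesis using that[OF X(1)] X(2) S.orientations_0_iff by blast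
  next
    case False
    then have b1: "b = 1" using b by blast
    then obtain f where f: "f \<in> edges (delete G S)" "f \<notin> S0" using edges by blast
    then have "edges (delete G S) \<noteq> {}" by blast
    then obtain e where "gen_orientation (delete G S) X" "bioriented X = {e}" "spans (delete G S) X e"
      using X(2) S.orientations_1_iff unfolding b1 by blast
    from S.move_bioriented[OF this f(1)]
    obtain Y where Y: "gen_orientation (delete G S) Y" "bioriented Y = {f}" "target_count G Y = target_count G X"
      by auto
    have "(X, Y) \<in> orient_equiv b (delete G S)"
      by (rule S.orient_equivI[OF b X(2) Y(1)]) (use Y b1 in simp_all)
    then have "Y \<in> C" unfolding X(3) by blast
    then show thesis using that[of Y] Y(2) f(2) by simp
  qed
qed

lemma push_class_OP:
  assumes b: "b \<in> {0, 1}" and p: "p \<in> OP b G"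
  shows "push_class b G S0 p \<in> OP b H"
proof -
  obtain S C where SC: "p = (S, C)" by fastforce
  interpret H: weighted_graph "delete H (S - S0)"
    by (rule weighted_graph.weighted_graph_delete[OF weighted_graph_H])
  have S: "S \<in> admissible_sets b G" and C: "C \<in> orientation_classes b (delete G S)"
    using p unfolding SC mem_OP by auto
  note S' = admissible_push[OF S]
  show ?thesis
  proof (cases "b = 1 \<and> edges (delete G S) \<subseteq> S0")
    case True
    then have b1: "b = 1" and edges: "edges (delete G S) \<subseteq> S0" by auto
    have "edges (delete H (S - S0)) = {}" using edges by (auto simp: contract_simps)
    moreover have "connected_graph (delete H (S - S0))" using S' b1 by (simp add: admissible_sets_def)
    ultimately have "{} \<in> orientations 1 (delete H (S - S0))"
      using H.orientations_1_edgeless H.connected_edgeless by blast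
    from orientation_class_mem(1)[OF this] show ?thesis
      using S' unfolding SC b1 push_class_edgeless[OF edges] weighted_graph.mem_OP[OF weighted_graph_H]
      by blast
  next
    case False
    obtain X where X: "X \<in> C" "bioriented X \<inter> S0 = {}" using representative_outside[OF b C False] .
    show ?thesis
      unfolding SC push_class_eq[OF b C X False] weighted_graph.mem_OP[OF weighted_graph_H]
      using S' orientation_class_mem(1) orientations_push[OF b orientation_class_eq(2)[OF C X(1)] X(2) False]
      by blast
  qed
qed


subsection \<open>Pulling back\<close>

text \<open>The dichotomy behind pulling back: a cut with a contracted edge is the business of the
  orientation on \<open>S0\<close>, and any other cut comes from the contraction.\<close>

lemma contracted_or_saturated:
  assumes Z: "Z \<subseteq> verts G" "enters (endpt G) (half_edges (delete G T)) Z" and T: "T \<inter> S0 = {}"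
  shows "enters (endpt G) (S0 \<times> UNIV) Z \<or>
    preim (proj ` Z) = Z \<and> enters (endpt H) (half_edges (delete H T)) (proj ` Z)"
proof (cases "enters (endpt G) (S0 \<times> UNIV) Z")
  case False
  have "T - S0 = T" using T by blast
  then show ?thesis
    using preim_proj[OF Z(1) False] enters_push[OF order_refl, of T "proj ` Z"] half_edges_delete_H[of T] Z(2)
    by simp
qed simp

text \<open>A contracted edge in the cut of a bridge would be that bridge. So the cut of a bridge
  outside \<open>S0\<close> comes from the contraction, which has no bridges after deleting
  \<open>T\<close>.\<close>

lemma bridges_pull:
  assumes T: "T \<inter> S0 = {}" "bridges (delete H T) = {}"
  shows "bridges (delete G T) \<subseteq> S0"
proof
  interpret T: weighted_graph "delete G T" by (rule weighted_graph_delete)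
  interpret H: weighted_graph "delete H T"
    by (rule weighted_graph.weighted_graph_delete[OF weighted_graph_H])
  fix e assume "e \<in> bridges (delete G T)"
  then obtain Z i where e: "e \<in> edges G - T" and Z: "Z \<subseteq> verts G" "endpt G e i \<in> Z" "endpt G e (\<not> i) \<notin> Z"
    and only: "\<forall>f\<in>edges G - T. \<forall>j. endpt G f j \<in> Z \<and> endpt G f (\<not> j) \<notin> Z \<longrightarrow> f = e"
    unfolding T.mem_bridges delete_simps by blast
  show "e \<in> S0"
  proof (rule ccontr)
    assume eS0: "e \<notin> S0"
    have "\<not> enters (endpt G) (S0 \<times> UNIV) Z"
    proof
      assume "enters (endpt G) (S0 \<times> UNIV) Z"
      then obtain f j where f: "f \<in> S0" "endpt G f j \<in> Z" "endpt G f (\<not> j) \<notin> Z"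
        by (auto simp: enters_def)
      then show False using only[rule_format, of f j] S0 T(1) eS0 by auto
    qed
    then have Zp: "preim (proj ` Z) = Z" using preim_proj Z(1) by blast
    have mem: "endpt H f j \<in> proj ` Z \<longleftrightarrow> endpt G f j \<in> Z" if "f \<in> edges G" for f j
      using mem_preim[OF that, of j "proj ` Z"] Zp by simp
    have "e \<in> bridges (delete H T)"
    proof (rule H.bridgesI)
      fix f j assume f: "f \<in> edges (delete H T)" "endpt (delete H T) f j \<in> proj ` Z"
        "endpt (delete H T) f (\<not> j) \<notin> proj ` Z"
      then have "f \<in> edges G - T" by (auto simp: contract_simps)
      then show "f = e" using only[rule_format, of f j] f mem by simp
    qed (use e eS0 Z mem in \<open>auto simp: contract_simps(1,2)\<close>)
    then show False using T(2) by blast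
  qed
qed

lemma connected_pull:
  assumes T: "T \<inter> S0 = {}" "connected_graph (delete H T)"
  shows "connected_graph (delete G T)"
proof -
  interpret T: weighted_graph "delete G T" by (rule weighted_graph_delete)
  interpret H: weighted_graph "delete H T"
    by (rule weighted_graph.weighted_graph_delete[OF weighted_graph_H])
  have conn: "verts H \<noteq> {}" "\<And>Z. Z \<subseteq> verts H \<Longrightarrow> Z \<noteq> {} \<Longrightarrow> Z \<noteq> verts H \<Longrightarrow>
      enters (endpt H) (half_edges (delete H T)) Z"
    using T(2) unfolding H.connected_graph_iff delete_simps by blast+
  have TS: "T - S0 = T" using T(1) by blast
  show ?thesis
    unfolding T.connected_graph_iff delete_simps
  proof (intro conjI allI impI)
    show "verts G \<noteq> {}" using conn(1) by (auto simp: contract_simps)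
    fix Z assume Z: "Z \<subseteq> verts G" "Z \<noteq> {} \<and> Z \<noteq> verts G"
    show "enters (endpt G) (half_edges (delete G T)) Z"
    proof (cases "enters (endpt G) (S0 \<times> UNIV) Z")
      case True
      then show ?thesis by (rule enters_mono) (use S0 T(1) in auto)
    next
      case False
      then have Zp: "preim (proj ` Z) = Z" using preim_proj Z(1) by blast
      then have "proj ` Z \<noteq> verts H" using Z(2) by (auto simp: preim_def contract_simps)
      then have "enters (endpt H) (half_edges (delete H T)) (proj ` Z)"
        using conn(2)[of "proj ` Z"] Z by (auto simp: contract_simps)
      then show ?thesis
        using enters_push[OF order_refl, of T "proj ` Z"] half_edges_delete_H[of T] TS Zp by simp
    qed
  qed
qed

lemma admissible_subset: "T \<in> admissible_sets b H \<Longrightarrow> T \<subseteq> edges G \<and> T \<inter> S0 = {}"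
  by (auto simp: admissible_sets_def contract_simps)

lemma admissible_pull:
  assumes b: "b \<in> {0, 1}" and T: "T \<in> admissible_sets b H"
  shows "pull_set b G T \<in> admissible_sets b G" "pull_set b G T - S0 = T"
proof -
  interpret T: weighted_graph "delete G T" by (rule weighted_graph_delete)
  note sub = admissible_subset[OF T]
  have "b = 0 \<or> b = 1" using b by blast
  then have "pull_set b G T \<in> admissible_sets b G \<and> pull_set b G T - S0 = T"
  proof
    assume b: "b = 0"
    have sub': "bridges (delete G T) \<subseteq> S0"
      by (rule bridges_pull) (use T b sub in \<open>auto simp: admissible_sets_def\<close>)
    have "finite (bridges (delete G T))" using sub' S0 finite_edges by (meson finite_subset)
    from T.delete_bridges(1)[OF this order_refl]
    have "bridges (delete G (T \<union> bridges (delete G T))) = {}" by (simp add: delete_delete)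
    then show ?thesis
      using b sub sub' S0 unfolding pull_set_def admissible_sets_def by auto
  next
    assume "b = 1"
    then show ?thesis
      using T sub connected_pull unfolding pull_set_def admissible_sets_def by auto
  qed
  then show "pull_set b G T \<in> admissible_sets b G" "pull_set b G T - S0 = T" by blast+
qed

text \<open>The condition on cuts with contracted edges is kept abstract because it is met in two
  ways: by biorienting all of \<open>S0\<close>, and by an earlier lift that is cyclic on a smaller
  graph containing \<open>S0\<close>.\<close>

lemma cyclic_pull:
  assumes T: "T \<inter> S0 = {}"
    and Y: "cyclic (delete H T) Y" "Y \<subseteq> half_edges (delete H T)"
    and X: "Y \<subseteq> X" "\<And>Z. Z \<subseteq> verts G \<Longrightarrow> enters (endpt G) (S0 \<times> UNIV) Z \<Longrightarrow> enters (endpt G) X Z"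
  shows "cyclic (delete G T) X"
  unfolding cyclic_def delete_simps
proof (intro allI impI)
  fix Z assume Z: "Z \<subseteq> verts G" "enters (endpt G) (half_edges (delete G T)) Z"
  show "enters (endpt G) X Z"
    using contracted_or_saturated[OF Z T]
  proof
    assume *: "preim (proj ` Z) = Z \<and> enters (endpt H) (half_edges (delete H T)) (proj ` Z)"
    moreover have "proj ` Z \<subseteq> verts H" using Z(1) by (auto simp: contract_simps)
    ultimately have "enters (endpt H) Y (proj ` Z)"
      using Y(1)[unfolded cyclic_def, rule_format, of "proj ` Z"] by simp
    moreover have "Y \<subseteq> half_edges G" using Y(2) by (auto simp: half_edges_def contract_simps)
    ultimately have "enters (endpt G) Y Z" using enters_H[of Y "proj ` Z"] * by simp
    then show ?thesis using X(1) enters_mono by blast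
  qed (rule X(2)[OF Z(1)])
qed

lemma spans_pull:
  assumes e: "e \<in> edges G" and Y: "spans (delete H T) Y e" "Y \<subseteq> half_edges H"
  shows "spans (delete G T) (Y \<union> S0 \<times> UNIV) e"
  unfolding spans_def delete_simps
proof (intro allI impI)
  fix Z assume Z: "Z \<subseteq> verts G" "Z \<noteq> {} \<and> (\<forall>i. endpt G e i \<notin> Z)"
  show "enters (endpt G) (Y \<union> S0 \<times> UNIV) Z"
  proof (cases "enters (endpt G) (S0 \<times> UNIV) Z")
    case True
    then show ?thesis by (rule enters_mono) auto
  next
    case False
    then have Zp: "preim (proj ` Z) = Z" using preim_proj Z(1) by blast
    have "proj ` Z \<subseteq> verts H" using Z(1) by (auto simp: contract_simps)
    moreover have "endpt H e i \<notin> proj ` Z" for i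
      using mem_preim[OF e, of i "proj ` Z"] Zp Z(2) by simp
    ultimately have "enters (endpt H) Y (proj ` Z)"
      using Y(1)[unfolded spans_def, rule_format, of "proj ` Z"] Z(2) by simp
    moreover have "Y \<subseteq> half_edges G" using Y(2) by (auto simp: half_edges_def contract_simps)
    ultimately have "enters (endpt G) Y Z" using enters_H[of Y "proj ` Z"] Zp by simp
    then show ?thesis by (rule enters_mono) auto
  qed
qed


subsection \<open>Lifting orientations\<close>

lemma gen_orientation_lift:
  assumes "S \<inter> S0 = {}" "gen_orientation (delete H S) X"
  shows "gen_orientation (delete G S) (X \<union> S0 \<times> UNIV)"
  using assms S0 by (auto simp: gen_orientation_def half_edges_def contract_simps)

text \<open>
  All contracted edges are first bioriented and then oriented by \<open>cyclic_reduce\<close>, which leaves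
  only bridges. The lift on \<open>G - S\<close> comes first, and the lift on \<open>G - T\<close> starts from its union
  with \<open>Y\<close>, so that the two lifts are compatible.
\<close>

lemma lift_totally_cyclic:
  assumes S: "S \<in> admissible_sets 0 H" and T: "T \<in> admissible_sets 0 H" and TS: "T \<subseteq> S"
    and X: "X \<in> orientations 0 (delete H S)" and Y: "Y \<in> orientations 0 (delete H T)"
    and XY: "restrict_orientation Y (delete H S) = X"
  shows "pull_set 0 G T \<subseteq> pull_set 0 G S \<and> (\<exists>X'\<in>orientations 0 (delete G (pull_set 0 G S)).
    \<exists>Y'\<in>orientations 0 (delete G (pull_set 0 G T)).
      restrict_orientation Y' (delete G (pull_set 0 G S)) = X' \<and>
      X' - S0 \<times> UNIV = X \<and> Y' - S0 \<times> UNIV = Y)"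
proof -
  interpret GS: weighted_graph "delete G S" by (rule weighted_graph_delete)
  interpret GT: weighted_graph "delete G T" by (rule weighted_graph_delete)
  interpret HS: weighted_graph "delete H S"
    by (rule weighted_graph.weighted_graph_delete[OF weighted_graph_H])
  interpret HT: weighted_graph "delete H T"
    by (rule weighted_graph.weighted_graph_delete[OF weighted_graph_H])
  define B where "B = bridges (delete G S)"
  define A where "A = bridges (delete G T)"
  have SS0: "S \<inter> S0 = {}" and TS0: "T \<inter> S0 = {}" using admissible_subset S T by blast+
  have TmS0: "T - S0 = T" and SmS0: "S - S0 = S" using SS0 TS0 by blast+
  have B: "B \<subseteq> S0" unfolding B_def by (rule bridges_pull[OF SS0]) (use S in \<open>simp add: admissible_sets_def\<close>)
  have A: "A \<subseteq> S0" unfolding A_def by (rule bridges_pull[OF TS0]) (use T in \<open>simp add: admissible_sets_def\<close>)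
  have fin: "finite A" "finite B" using A B S0 finite_edges by (meson finite_subset)+
  interpret GA: weighted_graph "delete G (T \<union> A)" by (rule weighted_graph_delete)
  interpret GB: weighted_graph "delete G (S \<union> B)" by (rule weighted_graph_delete)
  have pull: "pull_set 0 G S = S \<union> B" "pull_set 0 G T = T \<union> A" by (simp_all add: pull_set_def A_def B_def)
  have AB: "T \<union> A \<subseteq> S \<union> B" using bridges_delete_mono[OF TS] TS unfolding A_def B_def by blast
  have X': "gen_orientation (delete H S) X" "bioriented X = {}" "cyclic (delete H S) X"
    using X unfolding HS.orientations_0_iff by auto
  have Y': "gen_orientation (delete H T) Y" "bioriented Y = {}" "cyclic (delete H T) Y"
    using Y unfolding HT.orientations_0_iff by auto

  have "gen_orientation (delete G S) (X \<union> S0 \<times> UNIV)" by (rule gen_orientation_lift[OF SS0 X'(1)])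
  moreover have "cyclic (delete G S) (X \<union> S0 \<times> UNIV)"
    by (rule cyclic_pull[OF SS0 X'(3) gen_orientation_subset[OF X'(1)]]) (auto elim: enters_mono)
  ultimately obtain X1 where X1: "X1 \<subseteq> X \<union> S0 \<times> UNIV" "gen_orientation (delete G S) X1"
    "cyclic (delete G S) X1" "bioriented X1 \<subseteq> B"
    using GS.cyclic_reduce unfolding B_def by blast
  \<comment> \<open>\<open>X\<close> has no bioriented edge, so no half-edge over the contraction
    could have been dropped.\<close>
  have X1X: "X1 - S0 \<times> UNIV = X"
  proof (rule gen_orientation_eq)
    show "gen_orientation (delete H S) (X1 - S0 \<times> UNIV)"
      using gen_orientation_push[OF X1(2)] SmS0 by simp
    show "bioriented (X1 - S0 \<times> UNIV) = bioriented X"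
      using X1(4) B X'(2) by (auto simp: bioriented_minus)
  qed (use X1(1) X'(1) in auto)

  have genN: "gen_orientation (delete G T) (X1 \<union> Y)"
    unfolding gen_orientation_def
  proof
    show "X1 \<union> Y \<subseteq> half_edges (delete G T)"
      using gen_orientation_subset[OF X1(2)] gen_orientation_subset[OF Y'(1)] TS
      by (auto simp: half_edges_def contract_simps)
    show "\<forall>e\<in>edges (delete G T). \<exists>i. (e, i) \<in> X1 \<union> Y"
    proof
      fix e assume e: "e \<in> edges (delete G T)"
      show "\<exists>i. (e, i) \<in> X1 \<union> Y"
      proof (cases "e \<in> S0")
        case True
        then have "e \<in> edges (delete G S)" using e SS0 by auto
        then show ?thesis using X1(2) unfolding gen_orientation_def by blast
      next
        case False
        then have "e \<in> edges (delete H T)" using e by (simp add: contract_simps)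
        then show ?thesis using Y'(1) unfolding gen_orientation_def by blast
      qed
    qed
  qed
  \<comment> \<open>All of \<open>S0\<close> survives in \<open>delete G S\<close>, so
    \<open>X1\<close> enters every set crossed by a contracted edge.\<close>
  have cycN: "cyclic (delete G T) (X1 \<union> Y)"
  proof (rule cyclic_pull[OF TS0 Y'(3) gen_orientation_subset[OF Y'(1)]])
    fix Z assume Z: "Z \<subseteq> verts G" "enters (endpt G) (S0 \<times> UNIV) Z"
    have "S0 \<times> UNIV \<subseteq> half_edges (delete G S)" using S0 SS0 by auto
    with Z(2) have "enters (endpt G) (half_edges (delete G S)) Z" by (rule enters_mono)
    then have "enters (endpt G) X1 Z" using X1(3) Z(1) unfolding cyclic_def by simp
    then show "enters (endpt G) (X1 \<union> Y) Z" by (rule enters_mono) auto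
  qed auto
  obtain Y1 where Y1: "Y1 \<subseteq> X1 \<union> Y" "gen_orientation (delete G T) Y1"
    "cyclic (delete G T) Y1" "bioriented Y1 \<subseteq> A"
    using GT.cyclic_reduce[OF genN cycN] unfolding A_def by blast
  have XsubY: "X \<subseteq> Y" using XY restrict_orientation_subset by metis
  have Y1Y: "Y1 - S0 \<times> UNIV = Y"
  proof (rule gen_orientation_eq)
    show "gen_orientation (delete H T) (Y1 - S0 \<times> UNIV)"
      using gen_orientation_push[OF Y1(2)] TmS0 by simp
    show "bioriented (Y1 - S0 \<times> UNIV) = bioriented Y"
      using Y1(4) A Y'(2) by (auto simp: bioriented_minus)
    show "Y1 - S0 \<times> UNIV \<subseteq> Y" using Y1(1) X1(1) XsubY by blast
  qed (rule Y'(1))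

  \<comment> \<open>Only bridges are still bioriented; deleting them leaves honest
    \<open>0\<close>-orientations.\<close>
  let ?X = "X1 - B \<times> UNIV" and ?Y = "Y1 - A \<times> UNIV"
  have oX: "?X \<in> orientations 0 (delete G (S \<union> B))"
    unfolding GB.orientations_0_iff bioriented_minus
    using gen_orientation_delete[OF X1(2), of B] X1(4)
      GS.delete_bridges(2)[OF fin(2) _ gen_orientation_subset[OF X1(2)] X1(3)]
    by (simp add: delete_delete B_def)
  have oY: "?Y \<in> orientations 0 (delete G (T \<union> A))"
    unfolding GA.orientations_0_iff bioriented_minus
    using gen_orientation_delete[OF Y1(2), of A] Y1(4)
      GT.delete_bridges(2)[OF fin(1) _ gen_orientation_subset[OF Y1(2)] Y1(3)]
    by (simp add: delete_delete A_def)
  \<comment> \<open>It suffices to have one inclusion, as neither side has bioriented edges: a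
    half-edge of \<open>Y1\<close> comes from \<open>X1\<close> or from \<open>Y\<close>, and on
    edges of \<open>delete H S\<close> the latter is \<open>X\<close>.\<close>
  have restrict: "restrict_orientation ?Y (delete G (S \<union> B)) = ?X"
  proof (rule gen_orientation_eq)
    have genY: "gen_orientation (delete G (T \<union> A)) ?Y"
      using oY unfolding GA.orientations_0_iff by blast
    show "gen_orientation (delete G (S \<union> B)) (restrict_orientation ?Y (delete G (S \<union> B)))"
      using genY AB unfolding gen_orientation_def restrict_orientation_def by auto
    show "gen_orientation (delete G (S \<union> B)) ?X" using oX unfolding GB.orientations_0_iff by simp
    have "bioriented ?X = {}" "bioriented ?Y = {}"
      using oX oY unfolding GB.orientations_0_iff GA.orientations_0_iff by simp_all
    then show "bioriented (restrict_orientation ?Y (delete G (S \<union> B))) = bioriented ?X"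
      using bioriented_mono[OF restrict_orientation_subset, of ?Y "delete G (S \<union> B)"] by simp
    show "restrict_orientation ?Y (delete G (S \<union> B)) \<subseteq> ?X"
    proof (rule subrelI)
      fix e i assume "(e, i) \<in> restrict_orientation ?Y (delete G (S \<union> B))"
      then have e: "(e, i) \<in> Y1" "e \<in> edges G" "e \<notin> S" "e \<notin> B" by (auto simp: mem_restrict_orientation)
      consider "(e, i) \<in> X1" | "(e, i) \<in> Y" using Y1(1) e(1) by blast
      then have "(e, i) \<in> X1"
      proof cases
        case 2
        then have "e \<in> edges (delete H S)"
          using gen_orientation_edge[OF Y'(1)] e(3) by (auto simp: contract_simps)
        then have "(e, i) \<in> X" using 2 XY mem_restrict_orientation by metis
        then show ?thesis using X1X by blast
      qed
      then show "(e, i) \<in> ?X" using e(4) by blast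
    qed
  qed
  have "?X - S0 \<times> UNIV = X" "?Y - S0 \<times> UNIV = Y" using X1X Y1Y A B by blast+
  then show ?thesis unfolding pull using AB oX oY restrict by blast
qed

text \<open>Spanning is preserved by adding half-edges. So only \<open>X\<close> needs reducing; the
  union of its lift with \<open>Y\<close> has the same single bioriented edge and is rooted as it
  stands.\<close>

lemma lift_rooted:
  assumes S: "S \<inter> S0 = {}" and T: "T \<inter> S0 = {}" and TS: "T \<subseteq> S"
    and edges: "edges (delete H S) \<noteq> {}"
    and X: "X \<in> orientations 1 (delete H S)" and Y: "Y \<in> orientations 1 (delete H T)"
    and XY: "restrict_orientation Y (delete H S) = X"
  shows "\<exists>X'\<in>orientations 1 (delete G S). \<exists>Y'\<in>orientations 1 (delete G T).
      restrict_orientation Y' (delete G S) = X' \<and> bioriented X' \<inter> S0 = {} \<and> bioriented Y' \<inter> S0 = {} \<and>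
      X' - S0 \<times> UNIV = X \<and> Y' - S0 \<times> UNIV = Y"
proof -
  interpret GS: weighted_graph "delete G S" by (rule weighted_graph_delete)
  interpret GT: weighted_graph "delete G T" by (rule weighted_graph_delete)
  interpret HS: weighted_graph "delete H S"
    by (rule weighted_graph.weighted_graph_delete[OF weighted_graph_H])
  interpret HT: weighted_graph "delete H T"
    by (rule weighted_graph.weighted_graph_delete[OF weighted_graph_H])
  have TmS0: "T - S0 = T" and SmS0: "S - S0 = S" using S T by blast+
  have edgesT: "edges (delete H T) \<noteq> {}" using edges TS by auto
  have edgesG: "edges (delete G S) \<noteq> {}" "edges (delete G T) \<noteq> {}"
    using edges edgesT by (auto simp: contract_simps)
  obtain e where X': "gen_orientation (delete H S) X" "bioriented X = {e}" "spans (delete H S) X e"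
    using X HS.orientations_1_iff[OF edges] by blast
  obtain e' where Y': "gen_orientation (delete H T) Y" "bioriented Y = {e'}"
    using Y HT.orientations_1_iff[OF edgesT] by blast
  have XsubY: "X \<subseteq> Y" using XY restrict_orientation_subset by metis
  have "e' = e" using X'(2) Y'(2) bioriented_mono[OF XsubY] by simp
  note Y' = Y'[unfolded this]
  have "e \<in> edges (delete H S)" using HS.bioriented_subset_edges[OF X'(1)] X'(2) by blast
  then have e: "e \<in> edges G" "e \<notin> S0" by (auto simp: contract_simps)

  have "gen_orientation (delete G S) (X \<union> S0 \<times> UNIV)" by (rule gen_orientation_lift[OF S X'(1)])
  moreover have "spans (delete G S) (X \<union> S0 \<times> UNIV) e"
    by (rule spans_pull[OF e(1) X'(3)])
      (use gen_orientation_subset[OF X'(1)] in \<open>auto simp: half_edges_def\<close>)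
  moreover have "e \<in> bioriented (X \<union> S0 \<times> UNIV)"
    using X'(2) bioriented_mono[OF Un_upper1[of X "S0 \<times> UNIV"]] by blast
  ultimately obtain X1 where X1: "X1 \<subseteq> X \<union> S0 \<times> UNIV" "gen_orientation (delete G S) X1"
    "spans (delete G S) X1 e" "bioriented X1 = {e}"
    using GS.spans_reduce by blast
  have X1X: "X1 - S0 \<times> UNIV = X"
  proof (rule gen_orientation_eq)
    show "gen_orientation (delete H S) (X1 - S0 \<times> UNIV)"
      using gen_orientation_push[OF X1(2)] SmS0 by simp
    show "bioriented (X1 - S0 \<times> UNIV) = bioriented X"
      using X1(4) e(2) X'(2) by (auto simp: bioriented_minus)
  qed (use X1(1) X'(1) in auto)

  let ?Y = "X1 \<union> Y"
  have YS0: "Y \<inter> S0 \<times> UNIV = {}"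
    using gen_orientation_subset[OF Y'(1)] by (auto simp: half_edges_def contract_simps)
  have genY: "gen_orientation (delete G T) ?Y"
    unfolding gen_orientation_def
  proof
    show "?Y \<subseteq> half_edges (delete G T)"
      using gen_orientation_subset[OF X1(2)] gen_orientation_subset[OF Y'(1)] TS
      by (auto simp: half_edges_def contract_simps)
    show "\<forall>f\<in>edges (delete G T). \<exists>i. (f, i) \<in> ?Y"
    proof
      fix f assume f: "f \<in> edges (delete G T)"
      show "\<exists>i. (f, i) \<in> ?Y"
      proof (cases "f \<in> S0")
        case True
        then have "f \<in> edges (delete G S)" using f S by auto
        then show ?thesis using X1(2) unfolding gen_orientation_def by blast
      next
        case False
        then have "f \<in> edges (delete H T)" using f by (simp add: contract_simps)
        then show ?thesis using Y'(1) unfolding gen_orientation_def by blast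
      qed
    qed
  qed
  have YY: "?Y - S0 \<times> UNIV = Y" using X1X XsubY YS0 by blast
  have bioY: "bioriented ?Y = {e}"
  proof (intro equalityI subsetI)
    fix f assume f: "f \<in> bioriented ?Y"
    show "f \<in> {e}"
    proof (cases "f \<in> S0")
      case True
      then have "f \<in> bioriented X1" using f YS0 unfolding mem_bioriented by blast
      then show ?thesis using X1(4) by simp
    next
      case False
      then have "f \<in> bioriented (?Y - S0 \<times> UNIV)" using f by (simp add: bioriented_minus)
      then show ?thesis unfolding YY Y'(2) .
    qed
  next
    fix f assume "f \<in> {e}"
    then show "f \<in> bioriented ?Y" using X1(4) bioriented_mono[OF Un_upper1[of X1 Y]] by blast
  qed
  have spansY: "spans (delete G T) ?Y e"
    using X1(3) enters_mono[of "endpt G" X1 _ ?Y] unfolding spans_def delete_simps by blast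
  have oX: "X1 \<in> orientations 1 (delete G S)"
    unfolding GS.orientations_1_iff[OF edgesG(1)] using X1(2-4) by blast
  have oY: "?Y \<in> orientations 1 (delete G T)"
    unfolding GT.orientations_1_iff[OF edgesG(2)] using genY bioY spansY by blast
  have "restrict_orientation ?Y (delete G S) = X1"
  proof
    show "restrict_orientation ?Y (delete G S) \<subseteq> X1"
    proof (rule subrelI)
      fix f i assume f: "(f, i) \<in> restrict_orientation ?Y (delete G S)"
      show "(f, i) \<in> X1"
      proof (cases "(f, i) \<in> X1")
        case False
        then have "(f, i) \<in> Y" "f \<in> edges G - S" using f by (auto simp: mem_restrict_orientation)
        moreover from this have "f \<in> edges (delete H S)" using YS0 by (auto simp: contract_simps)
        ultimately have "(f, i) \<in> X" using XY mem_restrict_orientation by metis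
        then show ?thesis using X1X by blast
      qed
    qed
    show "X1 \<subseteq> restrict_orientation ?Y (delete G S)"
      using gen_orientation_subset[OF X1(2)] by (auto simp: restrict_orientation_def)
  qed
  moreover have "bioriented X1 \<inter> S0 = {}" "bioriented ?Y \<inter> S0 = {}"
    unfolding X1(4) bioY using e(2) by simp_all
  ultimately show ?thesis by (intro bexI[OF _ oX] bexI[OF _ oY] conjI X1X YY)
qed

text \<open>
  If \<open>H - S\<close> has no edges, then \<open>H\<close> has a single vertex and all orientations on \<open>H - T\<close> are
  equivalent, so any compatible orientations on \<open>G - S\<close> and \<open>G - T\<close> will do.
\<close>

lemma extend_rooted:
  assumes S: "connected_graph (delete G S)" "edges G - S \<subseteq> S0" and T: "T \<inter> S0 = {}" and TS: "T \<subseteq> S"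
    and S': "S \<inter> S0 = {}"
    and edges: "edges (delete H T) \<noteq> {}" and Y: "Y \<in> orientations 1 (delete H T)"
  shows "\<exists>X'\<in>orientations 1 (delete G S). \<exists>Y'\<in>orientations 1 (delete G T).
      restrict_orientation Y' (delete G S) = X'"
proof -
  interpret GS: weighted_graph "delete G S" by (rule weighted_graph_delete)
  interpret GT: weighted_graph "delete G T" by (rule weighted_graph_delete)
  interpret HT: weighted_graph "delete H T"
    by (rule weighted_graph.weighted_graph_delete[OF weighted_graph_H])
  have edgesT: "edges (delete G T) \<noteq> {}" using edges by (auto simp: contract_simps)
  have edgesS: "edges (delete G S) = S0" using S(2) S' S0 by auto
  obtain e where Y': "gen_orientation (delete H T) Y" "bioriented Y = {e}" "spans (delete H T) Y e"
    using Y HT.orientations_1_iff[OF edges] by blast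
  have "e \<in> edges (delete H T)" using HT.bioriented_subset_edges[OF Y'(1)] Y'(2) by blast
  then have e: "e \<in> edges G" by (auto simp: contract_simps)
  obtain X where X: "X \<in> orientations 1 (delete G S)" using GS.orientations_1_nonempty[OF S(1)] by blast
  have YS0: "Y \<inter> S0 \<times> UNIV = {}"
    using gen_orientation_subset[OF Y'(1)] by (auto simp: half_edges_def contract_simps)
  show ?thesis
  proof (cases "S0 = {}")
    \<comment> \<open>Here \<open>X\<close> is the empty orientation and offers no bioriented edge,
      so \<open>Y\<close> itself is used.\<close>
    case True
    have "gen_orientation (delete G T) Y" using gen_orientation_lift[OF T Y'(1)] True by simp
    moreover have "spans (delete G T) Y e"
      using spans_pull[OF e Y'(3)] True gen_orientation_subset[OF Y'(1)]
      by (auto simp: half_edges_def)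
    ultimately have "Y \<in> orientations 1 (delete G T)"
      unfolding GT.orientations_1_iff[OF edgesT] using Y'(2) by blast
    moreover have "X = {}" using GS.orientations_edgeless[OF _ X] edgesS True by simp
    moreover have "restrict_orientation Y (delete G S) = {}"
      using edgesS True by (auto simp: restrict_orientation_def half_edges_def)
    ultimately show ?thesis using X by blast
  next
    case False
    then have "edges (delete G S) \<noteq> {}" using edgesS by simp
    then obtain x where X': "gen_orientation (delete G S) X" "bioriented X = {x}" "spans (delete G S) X x"
      using X GS.orientations_1_iff by blast
    have XS0: "X \<subseteq> S0 \<times> UNIV" using gen_orientation_subset[OF X'(1)] unfolding half_edges_def edgesS .
    \<comment> \<open>The bioriented edge of the union is to be that of \<open>X\<close>, so the one
      of \<open>Y\<close> is directed; either direction would do, as \<open>X\<close> already spans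
      all vertices.\<close>
    let ?D = "Y - {(e, True)}"
    let ?Y = "X \<union> ?D"
    have genD: "gen_orientation (delete H T) ?D" by (rule gen_orientation_remove[OF Y'(1)]) (simp add: Y'(2))
    have "gen_orientation (delete G T) ?Y"
      unfolding gen_orientation_def
    proof
      show "?Y \<subseteq> half_edges (delete G T)"
        using gen_orientation_subset[OF X'(1)] gen_orientation_subset[OF genD] TS
        by (auto simp: half_edges_def contract_simps)
      show "\<forall>f\<in>edges (delete G T). \<exists>i. (f, i) \<in> ?Y"
      proof
        fix f assume f: "f \<in> edges (delete G T)"
        show "\<exists>i. (f, i) \<in> ?Y"
        proof (cases "f \<in> S0")
          case True
          then have "f \<in> edges (delete G S)" using edgesS by blast
          then show ?thesis using X'(1) unfolding gen_orientation_def by blast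
        next
          case False
          then have "f \<in> edges (delete H T)" using f by (simp add: contract_simps)
          then show ?thesis using genD unfolding gen_orientation_def by blast
        qed
      qed
    qed
    moreover have "bioriented ?Y = {x}"
    proof (intro equalityI subsetI)
      fix f assume f: "f \<in> bioriented ?Y"
      show "f \<in> {x}"
      proof (cases "f \<in> S0")
        case True
        then have "f \<in> bioriented X" using f YS0 unfolding mem_bioriented by blast
        then show ?thesis using X'(2) by simp
      next
        case False
        then have "f \<in> bioriented ?D" using f XS0 unfolding mem_bioriented by blast
        then show ?thesis using Y'(2) by (simp add: bioriented_remove)
      qed
    next
      fix f assume "f \<in> {x}"
      then show "f \<in> bioriented ?Y" using X'(2) bioriented_mono[OF Un_upper1[of X ?D]] by blast
    qed
    moreover have "spans (delete G T) ?Y x"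
      using X'(3) enters_mono[of "endpt G" X _ ?Y] unfolding spans_def delete_simps by blast
    ultimately have "?Y \<in> orientations 1 (delete G T)"
      unfolding GT.orientations_1_iff[OF edgesT] by blast
    moreover have "restrict_orientation ?Y (delete G S) = X"
      unfolding restrict_orientation_def half_edges_def edgesS using XS0 YS0 by blast
    ultimately show ?thesis using X by blast
  qed
qed

subsection \<open>The quotient of posets\<close>

lemma fst_push_class: "fst (push_class b G S0 (S, C)) = S - S0"
  by (simp add: push_class_def push_set_def Let_def)

lemma push_class_lift:
  assumes b: "b \<in> {0, 1}" and X': "X' \<in> orientations b (delete G S')" "bioriented X' \<inter> S0 = {}"
    and edges: "\<not> (b = 1 \<and> edges (delete G S') \<subseteq> S0)"
    and S: "S' - S0 = S" and C: "C \<in> orientation_classes b (delete H S)" "X' - S0 \<times> UNIV \<in> C"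
  shows "push_class b G S0 (S', orient_equiv b (delete G S') `` {X'}) = (S, C)"
  using push_class_eq[OF b orientation_class_mem[OF X'(1)] X'(2) edges]
    orientation_class_eq(1)[OF C] unfolding S by simp

lemma OP_order_pull:
  assumes b: "b \<in> {0, 1}"
    and S: "S \<in> admissible_sets b H" and T: "T \<in> admissible_sets b H"
    and sub: "pull_set b G T \<subseteq> pull_set b G S"
    and X: "X \<in> orientations b (delete G (pull_set b G S))"
    and Y: "Y \<in> orientations b (delete G (pull_set b G T))"
    and XY: "restrict_orientation Y (delete G (pull_set b G S)) = X"
  shows "((pull_set b G S, orient_equiv b (delete G (pull_set b G S)) `` {X}),
      (pull_set b G T, orient_equiv b (delete G (pull_set b G T)) `` {Y})) \<in> OP_order b G"
  unfolding mem_OP_order mem_OP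
  using admissible_pull(1)[OF b S] admissible_pull(1)[OF b T] sub XY
    orientation_class_mem[OF X] orientation_class_mem[OF Y] by blast

text \<open>The lifts are placed over \<open>pull_set\<close>, so that applying this to a reflexive
  pair also yields surjectivity over a fixed \<open>T\<close>.\<close>

lemma OP_order_lift:
  assumes b: "b \<in> {0, 1}" and le: "((S, C), (T, D)) \<in> OP_order b H"
  shows "\<exists>C' D'. ((pull_set b G S, C'), (pull_set b G T, D')) \<in> OP_order b G \<and>
    push_class b G S0 (pull_set b G S, C') = (S, C) \<and> push_class b G S0 (pull_set b G T, D') = (T, D)"
proof -
  note le' = le[unfolded weighted_graph.mem_OP_order[OF weighted_graph_H] weighted_graph.mem_OP[OF weighted_graph_H]]
  have S: "S \<in> admissible_sets b H" and C: "C \<in> orientation_classes b (delete H S)"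
    and T: "T \<in> admissible_sets b H" and D: "D \<in> orientation_classes b (delete H T)"
    and TS: "T \<subseteq> S" using le' by auto
  obtain X Y where XY: "X \<in> C" "Y \<in> D" "restrict_orientation Y (delete H S) = X" using le' by blast
  note X = orientation_class_eq(2)[OF C XY(1)] and Y = orientation_class_eq(2)[OF D XY(2)]
  note pullS = admissible_pull[OF b S] and pullT = admissible_pull[OF b T]
  have sub: "S \<subseteq> edges G" "S \<inter> S0 = {}" "T \<subseteq> edges G" "T \<inter> S0 = {}"
    using admissible_subset S T by blast+
  interpret HT: weighted_graph "delete H T"
    by (rule weighted_graph.weighted_graph_delete[OF weighted_graph_H])
  interpret HS: weighted_graph "delete H S"
    by (rule weighted_graph.weighted_graph_delete[OF weighted_graph_H])
  have "b = 0 \<or> b = 1" using b by blast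
  then show ?thesis
  proof
    assume b0: "b = 0"
    from lift_totally_cyclic[OF S[unfolded b0] T[unfolded b0] TS X[unfolded b0] Y[unfolded b0] XY(3)]
    obtain X' Y' where le: "pull_set b G T \<subseteq> pull_set b G S"
      and X': "X' \<in> orientations b (delete G (pull_set b G S))" "X' - S0 \<times> UNIV = X"
      and Y': "Y' \<in> orientations b (delete G (pull_set b G T))" "Y' - S0 \<times> UNIV = Y"
      and restrict: "restrict_orientation Y' (delete G (pull_set b G S)) = X'"
      unfolding b0 by blast
    have bio: "bioriented Z \<inter> S0 = {}" if "Z \<in> orientations b (delete G S')" for Z S'
    proof -
      interpret S': weighted_graph "delete G S'" by (rule weighted_graph_delete)
      show ?thesis using that unfolding b0 S'.orientations_0_iff by simp
    qed
    have "\<not> (b = 1 \<and> edges (delete G S') \<subseteq> S0)" for S' using b0 by simp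
    from push_class_lift[OF b X'(1) bio[OF X'(1)] this pullS(2) C] push_class_lift[OF b Y'(1) bio[OF Y'(1)] this pullT(2) D]
    show ?thesis
      using OP_order_pull[OF b S T le X'(1) Y'(1) restrict] XY(1,2) unfolding X'(2) Y'(2) by blast
  next
    assume b1: "b = 1"
    then have pull: "pull_set b G S = S" "pull_set b G T = T" by (simp_all add: pull_set_def)
    have conn: "connected_graph (delete G S)" "connected_graph (delete G T)"
      using pullS(1) pullT(1) b1 unfolding pull by (simp_all add: admissible_sets_def)
    show ?thesis
    proof (cases "edges G - S \<subseteq> S0")
      case False
      then have ne: "edges (delete H S) \<noteq> {}" by (auto simp: contract_simps)
      have out: "\<not> (b = 1 \<and> edges (delete G S) \<subseteq> S0)" "\<not> (b = 1 \<and> edges (delete G T) \<subseteq> S0)"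
        using False TS by auto
      from lift_rooted[OF sub(2,4) TS ne X[unfolded b1] Y[unfolded b1] XY(3)]
      obtain X' Y' where X': "X' \<in> orientations b (delete G S)" "bioriented X' \<inter> S0 = {}" "X' - S0 \<times> UNIV = X"
        and Y': "Y' \<in> orientations b (delete G T)" "bioriented Y' \<inter> S0 = {}" "Y' - S0 \<times> UNIV = Y"
        and restrict: "restrict_orientation Y' (delete G S) = X'"
        unfolding b1 by blast
      note pullS = pullS[unfolded pull] and pullT = pullT[unfolded pull]
      from push_class_lift[OF b X'(1,2) out(1) pullS(2) C] push_class_lift[OF b Y'(1,2) out(2) pullT(2) D]
      show ?thesis
        using OP_order_pull[OF b S T, unfolded pull, OF TS X'(1) Y'(1) restrict] XY(1,2)
        unfolding X'(3) Y'(3) pull by blast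
    next
      case True
      have "connected_graph (delete H S)" using S b1 by (simp add: admissible_sets_def)
      moreover have "edges (delete H S) = {}" using True by (auto simp: contract_simps)
      ultimately have single: "card (verts H) = 1" using HS.connected_edgeless by simp
      \<comment> \<open>On a single vertex there is at most one class for each deleted set, so the
        image under \<open>push_class\<close> is known from its first component.\<close>
      have push: "push_class b G S0 p = (R, F)"
        if p: "p \<in> OP b G" "fst p = R" and R: "R \<inter> S0 = {}" and F: "F \<in> orientation_classes b (delete H R)" for p R F
      proof -
        interpret HR: weighted_graph "delete H R"
          by (rule weighted_graph.weighted_graph_delete[OF weighted_graph_H])
        obtain F' where F': "push_class b G S0 p = (R, F')"
          using fst_push_class[of b "fst p" "snd p"] p(2) R by (metis Diff_triv prod.collapse)
        then have "F' \<in> orientation_classes b (delete H R)"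
          using push_class_OP[OF b p(1)] weighted_graph.mem_OP[OF weighted_graph_H] by metis
        then have "F' = F" using HR.orientation_class_unique[OF b _ _ F] single by simp
        then show ?thesis using F' by simp
      qed
      have "\<exists>X'\<in>orientations b (delete G S). \<exists>Y'\<in>orientations b (delete G T).
          restrict_orientation Y' (delete G S) = X'"
      proof (cases "edges (delete H T) = {}")
        case False
        from extend_rooted[OF conn(1) True sub(4) TS sub(2) False Y[unfolded b1]]
        show ?thesis unfolding b1 .
      next
        case HT: True
        interpret GS: weighted_graph "delete G S" by (rule weighted_graph_delete)
        \<comment> \<open>Both sets consist of all edges outside \<open>S0\<close>.\<close>
        have "S = T" using HT True sub TS by (auto simp: contract_simps)
        moreover obtain X' where "X' \<in> orientations b (delete G S)"
          using GS.orientations_1_nonempty[OF conn(1)] unfolding b1 by blast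
        moreover from this have "restrict_orientation X' (delete G S) = X'"
          using GS.restrict_orientation_id GS.orientations_gen b by blast
        ultimately show ?thesis by blast
      qed
      then obtain X' Y' where X': "X' \<in> orientations b (delete G S)" and Y': "Y' \<in> orientations b (delete G T)"
        and restrict: "restrict_orientation Y' (delete G S) = X'" by blast
      let ?p = "(S, orient_equiv b (delete G S) `` {X'})" and ?q = "(T, orient_equiv b (delete G T) `` {Y'})"
      have le: "(?p, ?q) \<in> OP_order b G"
        by (rule OP_order_pull[OF b S T, unfolded pull, OF TS X' Y' restrict])
      then have "?p \<in> OP b G" "?q \<in> OP b G" unfolding mem_OP_order by blast+
      then have "push_class b G S0 ?p = (S, C)" "push_class b G S0 ?q = (T, D)"
        using push sub C D by simp_all
      then show ?thesis using le unfolding pull by blast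
    qed
  qed
qed

text \<open>The given representatives may have their bioriented edge in \<open>S0\<close>. A better
  one is chosen on the smaller graph \<open>delete G S\<close> and glued into
  \<open>Y\<close>.\<close>

lemma push_class_mono:
  assumes b: "b \<in> {0, 1}" and le: "((S, C), (T, D)) \<in> OP_order b G"
  shows "(push_class b G S0 (S, C), push_class b G S0 (T, D)) \<in> OP_order b H"
proof -
  have SC: "(S, C) \<in> OP b G" and TD: "(T, D) \<in> OP b G" and TS: "T \<subseteq> S"
    using le unfolding mem_OP_order by auto
  obtain X Y where XY: "X \<in> C" "Y \<in> D" "restrict_orientation Y (delete G S) = X"
    using le unfolding mem_OP_order by blast
  have C: "C \<in> orientation_classes b (delete G S)" and D: "D \<in> orientation_classes b (delete G T)"
    using SC TD unfolding mem_OP by auto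
  interpret GS: weighted_graph "delete G S" by (rule weighted_graph_delete)
  interpret GT: weighted_graph "delete G T" by (rule weighted_graph_delete)
  obtain C' where C': "push_class b G S0 (S, C) = (S - S0, C')" using fst_push_class by (metis prod.collapse)
  obtain D' where D': "push_class b G S0 (T, D) = (T - S0, D')" using fst_push_class by (metis prod.collapse)
  have CD': "(S - S0, C') \<in> OP b H" "(T - S0, D') \<in> OP b H"
    using push_class_OP[OF b SC] push_class_OP[OF b TD] unfolding C' D' .
  then have classes: "C' \<in> orientation_classes b (delete H (S - S0))" "D' \<in> orientation_classes b (delete H (T - S0))"
    unfolding weighted_graph.mem_OP[OF weighted_graph_H] by auto
  have "\<exists>X\<in>C'. \<exists>Y\<in>D'. restrict_orientation Y (delete H (S - S0)) = X"
  proof (cases "b = 1 \<and> edges (delete G S) \<subseteq> S0")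
    case True
    interpret HS: weighted_graph "delete H (S - S0)"
      by (rule weighted_graph.weighted_graph_delete[OF weighted_graph_H])
    have none: "edges (delete H (S - S0)) = {}" using True by (auto simp: contract_simps)
    obtain X' where X': "X' \<in> C'" "X' \<in> orientations b (delete H (S - S0))"
      using orientation_class_nonempty[OF classes(1)] .
    obtain Y' where Y': "Y' \<in> D'" using orientation_class_nonempty[OF classes(2)] .
    have "X' = {}" using HS.orientations_edgeless[OF none X'(2) b] .
    moreover have "restrict_orientation Y' (delete H (S - S0)) = {}"
      using none by (auto simp: restrict_orientation_def half_edges_def)
    ultimately show ?thesis using X'(1) Y' by blast
  next
    case False
    then have FalseT: "\<not> (b = 1 \<and> edges (delete G T) \<subseteq> S0)" using TS by auto
    obtain X' where X': "X' \<in> C" "bioriented X' \<inter> S0 = {}" using representative_outside[OF b C False] .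
    have "(restrict_orientation Y (delete G S), X') \<in> orient_equiv b (delete G S)"
      using X'(1) orientation_class_eq(1)[OF C XY(1)] unfolding XY(3) by blast
    from glue_orientations[OF b orientation_class_eq(2)[OF D XY(2)] TS this]
    obtain Y' where Y': "(Y, Y') \<in> orient_equiv b (delete G T)" "restrict_orientation Y' (delete G S) = X'"
      by blast
    then have Y'D: "Y' \<in> D" using orientation_class_eq(1)[OF D XY(2)] by blast
    have oX: "X' \<in> orientations b (delete G S)" and oY: "Y' \<in> orientations b (delete G T)"
      using orientation_class_eq(2)[OF C X'(1)] orientation_class_eq(2)[OF D Y'D] .
    have sub: "bioriented X' \<subseteq> bioriented Y'"
      unfolding Y'(2)[symmetric] by (rule bioriented_mono[OF restrict_orientation_subset])
    \<comment> \<open>The bioriented edge of the extension is already that of \<open>X'\<close>, so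
      it also lies outside \<open>S0\<close> and both images can be computed by restriction.\<close>
    have "bioriented Y' = bioriented X'"
    proof (cases "b = 0")
      case True
      then show ?thesis using oX oY unfolding True GS.orientations_0_iff GT.orientations_0_iff by simp
    next
      case b0: False
      then have "edges (delete G S) \<noteq> {}" "edges (delete G T) \<noteq> {}" using False FalseT b by auto
      then show ?thesis
        using card_subset_eq[OF GT.finite_bioriented[OF GT.orientations_gen[OF oY b]] sub]
          GS.orientations_card[OF oX b] GT.orientations_card[OF oY b] by simp
    qed
    then have bioY: "bioriented Y' \<inter> S0 = {}" using X'(2) by simp
    have "C' = orient_equiv b (delete H (S - S0)) `` {X' - S0 \<times> UNIV}"
      using push_class_eq[OF b C X' False] C' by simp
    then have mX: "X' - S0 \<times> UNIV \<in> C'"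
      using orientation_class_mem(2)[OF orientations_push[OF b oX X'(2) False]] by simp
    have "D' = orient_equiv b (delete H (T - S0)) `` {Y' - S0 \<times> UNIV}"
      using push_class_eq[OF b D Y'D bioY FalseT] D' by simp
    then have mY: "Y' - S0 \<times> UNIV \<in> D'"
      using orientation_class_mem(2)[OF orientations_push[OF b oY bioY FalseT]] by simp
    have "restrict_orientation (Y' - S0 \<times> UNIV) (delete H (S - S0)) = X' - S0 \<times> UNIV"
      unfolding Y'(2)[symmetric] by (auto simp: restrict_orientation_def half_edges_delete_H)
    then show ?thesis using mX mY by blast
  qed
  moreover have "T - S0 \<subseteq> S - S0" using TS by blast
  ultimately show ?thesis
    unfolding C' D' weighted_graph.mem_OP_order[OF weighted_graph_H] using CD' by blast
qed

lemma poset_quotient_push_class: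
  assumes b: "b \<in> {0, 1}"
  shows "poset_quotient (OP b G) (OP_order b G) (OP b H) (OP_order b H) (push_class b G S0)"
  unfolding poset_quotient_def
proof (intro conjI allI impI)
  show "partial_order_on (OP b G) (OP_order b G)" by (rule partial_order_OP[OF b])
  show "partial_order_on (OP b H) (OP_order b H)"
    by (rule weighted_graph.partial_order_OP[OF weighted_graph_H b])
  show "push_class b G S0 \<in> OP b G \<rightarrow> OP b H" using push_class_OP[OF b] by blast
  show "monotone_on (OP b G) (\<lambda>x y. (x, y) \<in> OP_order b G) (\<lambda>x y. (x, y) \<in> OP_order b H) (push_class b G S0)"
  proof (rule monotone_onI)
    fix p q assume "(p, q) \<in> OP_order b G"
    then show "(push_class b G S0 p, push_class b G S0 q) \<in> OP_order b H"
      using push_class_mono[OF b, of "fst p" "snd p" "fst q" "snd q"] by simp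
  qed
  fix q1 q2 assume "(q1, q2) \<in> OP_order b H"
  then obtain C' D' where "((pull_set b G (fst q1), C'), (pull_set b G (fst q2), D')) \<in> OP_order b G"
    "push_class b G S0 (pull_set b G (fst q1), C') = q1" "push_class b G S0 (pull_set b G (fst q2), D') = q2"
    using OP_order_lift[OF b, of "fst q1" "snd q1" "fst q2" "snd q2"] by auto
  moreover from this have "(pull_set b G (fst q1), C') \<in> OP b G" "(pull_set b G (fst q2), D') \<in> OP b G"
    unfolding mem_OP_order by blast+
  ultimately show "\<exists>p1\<in>OP b G. \<exists>p2\<in>OP b G. push_class b G S0 p1 = q1 \<and> push_class b G S0 p2 = q2 \<and>
      (p1, p2) \<in> OP_order b G" by blast
qed

lemma push_class_onto:
  assumes b: "b \<in> {0, 1}" and T: "T \<in> admissible_sets b H"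
  shows "push_class b G S0 ` ({pull_set b G T} \<times> orientation_classes b (delete G (pull_set b G T)))
    = {T} \<times> orientation_classes b (delete H T)"
proof (intro equalityI subsetI)
  fix q assume "q \<in> push_class b G S0 ` ({pull_set b G T} \<times> orientation_classes b (delete G (pull_set b G T)))"
  then obtain C where C: "C \<in> orientation_classes b (delete G (pull_set b G T))"
    "q = push_class b G S0 (pull_set b G T, C)" by blast
  obtain D where q: "q = (T, D)"
    using fst_push_class[of b "pull_set b G T" C] admissible_pull(2)[OF b T] C(2) by (metis prod.collapse)
  have "(pull_set b G T, C) \<in> OP b G" using admissible_pull(1)[OF b T] C(1) by (simp add: mem_OP)
  then have "q \<in> OP b H" unfolding C(2) by (rule push_class_OP[OF b])
  then show "q \<in> {T} \<times> orientation_classes b (delete H T)"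
    unfolding q weighted_graph.mem_OP[OF weighted_graph_H] by blast
next
  fix q assume "q \<in> {T} \<times> orientation_classes b (delete H T)"
  then obtain D where q: "q = (T, D)" "D \<in> orientation_classes b (delete H T)" by blast
  then have "(T, D) \<in> OP b H" using T weighted_graph.mem_OP[OF weighted_graph_H] by blast
  then have "((T, D), (T, D)) \<in> OP_order b H"
    using weighted_graph.partial_order_OP[OF weighted_graph_H b]
    unfolding partial_order_on_def preorder_on_def by (auto elim: refl_onD)
  from OP_order_lift[OF b this] obtain D' where "(pull_set b G T, D') \<in> OP b G"
    "push_class b G S0 (pull_set b G T, D') = (T, D)"
    unfolding mem_OP_order by blast
  then show "q \<in> push_class b G S0 ` ({pull_set b G T} \<times> orientation_classes b (delete G (pull_set b G T)))"
    unfolding q(1) mem_OP by (metis SigmaI image_eqI singletonI)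
qed

end

theorem theorem2p4p1:
  fixes G :: "('v, 'e) wgraph" and S0 :: "'e set" and b :: nat
  assumes "weighted_graph G"
    and "S0 \<subset> edges G"
    and "b \<in> {0, 1}"
  shows "poset_quotient (OP b G) (OP_order b G)
           (OP b (contract G S0)) (OP_order b (contract G S0)) (push_class b G S0)
       \<and> (\<forall>T\<in>admissible_sets b (contract G S0).
            push_class b G S0 `
              ({pull_set b G T} \<times> orientation_classes b (delete G (pull_set b G T)))
            = {T} \<times> orientation_classes b (delete (contract G S0) T))"
proof -
  interpret contraction G S0
    using assms(1,2) by (auto simp: contraction_def contraction_axioms_def)
  show ?thesis using poset_quotient_push_class[OF assms(3)] push_class_onto[OF assms(3)] by blast
qed

end
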